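(* Let $\mathbb{F}$ be a field. Let $\mathcal{S}$ be an optimal weakly triangularizable subspace of $\mathrm{M}_n(\mathbb{F})$. Then there is a partition $n=n_1+\cdots+n_p$ into positive integers, and for every $i \in \{1,\dots,p\}$ there is an irreducible optimal weakly triangularizable subspace $\mathcal{S}_i$ of $\mathrm{M}_{n_i}(\mathbb{F})$, such that $$\mathcal{S} \simeq \mathcal{S}_1 \vee \cdots \vee \mathcal{S}_p.$$ Moreover, the (ordered) partition $(n_1,\dots,n_p)$ is uniquely determined by the similarity class of $\mathcal{S}$, and so is the similarity class of $\mathcal{S}_i$ for each $i \in \{1,\dots,p\}$. Conversely, let $n=n_1+\cdots+n_p$ be a partition into positive integers, and for each $i \in \{1,\dots,p\}$ let $\mathcal{S}_i$ be an irreducible optimal weakly triangularizable subspace of $\mathrm{M}_{n_i}(\mathbb{F})$. If in addition $t_n(\mathbb{F})=\sum_{k=1}^p t_{n_k}(\mathbb{F})+\sum_{1 \leq i<j \leq p} n_i n_j$, then $\mathcal{S}_1 \vee \cdots \vee \mathcal{S}_p$ is an optimal weakly triangularizable subspace of $\mathrm{M}_n(\mathbb{F})$.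
   Context: $\mathrm{M}_{n,p}(\mathbb{F})$ is the space of $n\times p$ matrices over the field $\mathbb{F}$, and $\mathrm{M}_n(\mathbb{F})=\mathrm{M}_{n,n}(\mathbb{F})$. A linear subspace of $\mathrm{M}_n(\mathbb{F})$ is weakly triangularizable when all its elements are triangularizable over $\mathbb{F}$ (similar over $\mathbb{F}$ to an upper-triangular matrix). $t_n(\mathbb{F})$ is the greatest possible dimension of a weakly triangularizable linear subspace of $\mathrm{M}_n(\mathbb{F})$; such a subspace is optimal when its dimension equals $t_n(\mathbb{F})$. A linear subspace of $\mathrm{M}_n(\mathbb{F})$ is irreducible when no linear subspace of $\mathbb{F}^n$ other than $\{0\}$ and $\mathbb{F}^n$ is invariant under all its elements. Two subsets $\mathcal{X},\mathcal{Y}$ of $\mathrm{M}_n(\mathbb{F})$ are similar, written $\mathcal{X}\simeq\mathcal{Y}$, when $\mathcal{Y}=P\mathcal{X}P^{-1}$ for some $P\in \mathrm{GL}_n(\mathbb{F})$. For linear subspaces $\mathcal{A}\subseteq \mathrm{M}_n(\mathbb{F})$ and $\mathcal{B}\subseteq\mathrm{M}_p(\mathbb{F})$ (with $n,p>0$), the joint $\mathcal{A}\vee\mathcal{B}\subseteq \mathrm{M}_{n+p}(\mathbb{F})$ is the set of all matrices $\begin{bmatrix} A & C\\ 0 & B\end{bmatrix}$ with $A\in\mathcal{A}$, $B\in\mathcal{B}$, $C\in\mathrm{M}_{n,p}(\mathbb{F})$; this operation is associative, so iterated joints are well defined. *)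

theory Defs
  imports "Jordan_Normal_Form.VS_Connect"
begin

definition mat_subspace :: "nat \<Rightarrow> 'a::field mat set \<Rightarrow> bool" where
  "mat_subspace n S \<longleftrightarrow> VectorSpace.subspace class_ring S (module_mat TYPE('a) n n)"

definition mat_subspace_dim :: "nat \<Rightarrow> 'a::field mat set \<Rightarrow> nat" where
  "mat_subspace_dim n S = vectorspace.dim class_ring ((module_mat TYPE('a) n n)\<lparr>carrier := S\<rparr>)"

definition triangularizable :: "'a::field mat \<Rightarrow> bool" where
  "triangularizable A \<longleftrightarrow> (\<exists>T. similar_mat A T \<and> upper_triangular T)"

definition weakly_triangularizable :: "nat \<Rightarrow> 'a::field mat set \<Rightarrow> bool" where
  "weakly_triangularizable n S \<longleftrightarrow> mat_subspace n S \<and> (\<forall>A\<in>S. triangularizable A)"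

(* t_n(F), with F the type 'a. The set is finite and nonempty: the dimensions are at most n * n,
   and the zero subspace is weakly triangularizable. *)
definition max_wt_dim :: "'a::field itself \<Rightarrow> nat \<Rightarrow> nat" where
  "max_wt_dim ty n = Max {mat_subspace_dim n S | S :: 'a mat set. weakly_triangularizable n S}"

definition optimal_wt :: "nat \<Rightarrow> 'a::field mat set \<Rightarrow> bool" where
  "optimal_wt n S \<longleftrightarrow>
     weakly_triangularizable n S \<and> mat_subspace_dim n S = max_wt_dim TYPE('a) n"

definition irreducible_mats :: "nat \<Rightarrow> 'a::field mat set \<Rightarrow> bool" where
  "irreducible_mats n S \<longleftrightarrow>
     (\<forall>W. VectorSpace.subspace class_ring W (module_vec TYPE('a) n) \<and>
          (\<forall>A\<in>S. \<forall>w\<in>W. A *\<^sub>v w \<in> W) \<longrightarrow>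
          W = {0\<^sub>v n} \<or> W = carrier_vec n)"

definition irreducible_optimal_wt :: "nat \<Rightarrow> 'a::field mat set \<Rightarrow> bool" where
  "irreducible_optimal_wt n S \<longleftrightarrow> irreducible_mats n S \<and> optimal_wt n S"

definition similar_sets :: "nat \<Rightarrow> 'a::field mat set \<Rightarrow> 'a mat set \<Rightarrow> bool" where
  "similar_sets n X Y \<longleftrightarrow>
     (\<exists>P Q. P \<in> carrier_mat n n \<and> Q \<in> carrier_mat n n \<and>
            P * Q = 1\<^sub>m n \<and> Q * P = 1\<^sub>m n \<and> Y = (\<lambda>A. P * A * Q) ` X)"

(* The block sizes are read off the matrices A and B themselves, so for \<A> \<subseteq> carrier_mat n n and
   \<B> \<subseteq> carrier_mat p p the matrix C ranges over all of carrier_mat n p. *)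
definition joint :: "'a::field mat set \<Rightarrow> 'a mat set \<Rightarrow> 'a mat set" where
  "joint \<A> \<B> =
     {four_block_mat A C (0\<^sub>m (dim_row B) (dim_col A)) B | A B C.
        A \<in> \<A> \<and> B \<in> \<B> \<and> C \<in> carrier_mat (dim_row A) (dim_col B)}"

(* The empty joint, which arises only for n = 0, is the unique space of 0 x 0 matrices. *)
fun joints :: "'a::field mat set list \<Rightarrow> 'a mat set" where
  "joints [] = {0\<^sub>m 0 0}"
| "joints [\<A>] = \<A>"
| "joints (\<A> # \<B> # \<C>s) = joint \<A> (joints (\<B> # \<C>s))"

definition irreducible_optimal_blocks :: "nat list \<Rightarrow> 'a::field mat set list \<Rightarrow> bool" where
  "irreducible_optimal_blocks ns Ss \<longleftrightarrow>
     length Ss = length ns \<and>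
     (\<forall>i<length ns. ns ! i > 0 \<and> irreducible_optimal_wt (ns ! i) (Ss ! i))"

end

theory Submission
  imports Defs "Jordan_Normal_Form.DL_Rank" "Jordan_Normal_Form.Char_Poly"
begin

text \<open>
Existence rests on a dimension count. If an optimal space \<open>S\<close> of \<open>n \<times> n\<close> matrices leaves a
proper nonzero subspace of dimension \<open>a\<close> invariant, then after a change of basis every element is
block upper triangular, with diagonal blocks ranging over spaces \<open>A\<close> (of size \<open>a\<close>) and \<open>B\<close> (of size
\<open>b = n - a\<close>). A matrix is triangularizable exactly when its characteristic polynomial splits, and the
characteristic polynomial of a block upper triangular matrix is the product of those of its diagonal
blocks; hence \<open>A\<close> and \<open>B\<close> are weakly triangularizable, and so is the joint of \<open>A\<close> and \<open>B\<close>. This joint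
contains \<open>S\<close>, so optimality forces equality. As the dimension of a joint is
\<open>dim A + dim B + a * b\<close>, replacing \<open>A\<close> or \<open>B\<close> by a larger weakly triangularizable space would
enlarge the joint, so both factors are optimal and induction on \<open>n\<close> applies
(\<open>reducible_optimal_wt_similar_joint\<close>). The same dimension formula gives the converse: under the
numerical hypothesis the joint reaches the maximal dimension.

Uniqueness comes from irreducibility. In a joint of \<open>A\<close> and \<open>R\<close> with \<open>A\<close> irreducible of size \<open>a\<close>, the
span of the first \<open>a\<close> coordinate vectors is the least nonzero invariant subspace
(\<open>invariant_subspace_contains_coord_space\<close>). A matrix that conjugates one joint onto another
therefore carries the least invariant subspace of the first onto that of the second. So the leading
sizes agree, the conjugating matrix is block upper triangular, and its diagonal blocks conjugate the
leading factors and the remaining joints separately; induction on the list of factors finishes the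
proof (\<open>similar_joints_factors\<close>, \<open>similar_joints_unique\<close>).
\<close>

section \<open>Dimensions of spaces of matrices\<close>

text \<open>
Linearly independent subsets of \<open>W\<close> have at most \<open>dim\<close> elements, so one of them is maximal, and a
maximal one is a finite basis.
\<close>
lemma (in vectorspace) subspace_fin_dim:
  assumes "fin_dim" and W: "VectorSpace.subspace K W V"
  shows "vectorspace.fin_dim K (vs W)"
proof -
  interpret W: vectorspace K "vs W"
    using W by (rule subspace_is_vs)
  have sub: "submodule K W V" and WV: "W \<subseteq> carrier V"
    using W by (auto simp: VectorSpace.subspace_def LinearCombinations.submodule_def)
  have li: "W.lin_indpt A \<longleftrightarrow> lin_indpt A" if "A \<subseteq> W" for A
    using span_li_not_depend(2)[OF that sub] by simp
  have bound: "finite A \<and> card A \<le> dim" if "A \<subseteq> W \<and> lin_indpt A" for A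
    using li_le_dim[OF \<open>fin_dim\<close>, of A] that WV by auto
  have "lin_indpt {}"
    by (simp add: lin_dep_def)
  then obtain A where A: "finite A" "maximal A (\<lambda>A. A \<subseteq> W \<and> lin_indpt A)"
    using maximal_exists[of "\<lambda>A. A \<subseteq> W \<and> lin_indpt A" dim "{}", OF bound] by auto
  then have "maximal A (\<lambda>A. A \<subseteq> carrier (vs W) \<and> W.lin_indpt A)"
    using li by (auto simp: maximal_def)
  then have "W.basis A"
    by (rule W.max_li_is_basis)
  with A show ?thesis
    by (auto simp: W.fin_dim_def W.basis_def)
qed

text \<open>
A basis of \<open>W\<close> stays linearly independent in \<open>V\<close>; having \<open>dim\<close> elements it is a basis of \<open>V\<close> too.
\<close>
lemma (in vectorspace) subspace_dim_eq_imp_full: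
  assumes fd: "fin_dim" and W: "VectorSpace.subspace K W V" and eq: "vectorspace.dim K (vs W) = dim"
  shows "W = carrier V"
proof -
  interpret W: vectorspace K "vs W"
    using W by (rule subspace_is_vs)
  have sub: "submodule K W V" and WV: "W \<subseteq> carrier V"
    using W by (auto simp: VectorSpace.subspace_def LinearCombinations.submodule_def)
  obtain A where A: "finite A" "W.basis A"
    using W.finite_basis_exists subspace_fin_dim[OF fd W] by blast
  have AW: "A \<subseteq> W" and li: "W.lin_indpt A" and gen: "W.span A = W"
    using A by (auto simp: W.basis_def)
  have "card A = dim"
    using W.dim_basis[OF A] eq by simp
  moreover have "lin_indpt A"
    using li span_li_not_depend(2)[OF AW sub] by simp
  ultimately have "basis A"
    using dim_li_is_basis[OF fd, of A] A AW WV by auto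
  then show ?thesis
    using gen span_li_not_depend(1)[OF AW sub] by (simp add: basis_def)
qed

lemma mat_subspace_iff:
  "mat_subspace n (S :: 'a::field mat set) \<longleftrightarrow> S \<subseteq> carrier_mat n n \<and> 0\<^sub>m n n \<in> S
     \<and> (\<forall>A\<in>S. \<forall>B\<in>S. A + B \<in> S) \<and> (\<forall>c. \<forall>A\<in>S. c \<cdot>\<^sub>m A \<in> S)"
proof -
  have "Module.module (class_ring :: 'a ring) (module_mat TYPE('a) n n)"
    using matrix_vs[where 'a='a] by (simp add: vectorspace_def)
  then show ?thesis
    unfolding mat_subspace_def VectorSpace.subspace_def LinearCombinations.submodule_def
    by (auto simp: matrix_vs matrix_vs_simps)
qed

lemma vec_subspace_iff:
  "VectorSpace.subspace class_ring W (module_vec TYPE('a::field) n) \<longleftrightarrow>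
     W \<subseteq> carrier_vec n \<and> 0\<^sub>v n \<in> W \<and> (\<forall>v\<in>W. \<forall>w\<in>W. v + w \<in> W) \<and> (\<forall>c. \<forall>v\<in>W. c \<cdot>\<^sub>v v \<in> W)"
proof -
  show ?thesis
    unfolding VectorSpace.subspace_def LinearCombinations.submodule_def
    by (auto simp: vec_vs vec_module module_vec_simps)
qed

abbreviation mat_vs :: "nat \<Rightarrow> 'a::field mat set \<Rightarrow> ('a, 'a mat) Module.module" where
  "mat_vs n S \<equiv> (module_mat TYPE('a) n n)\<lparr>carrier := S\<rparr>"

lemma mat_vs_simps:
  "carrier (mat_vs n S) = S" "add (mat_vs n S) = (+)" "zero (mat_vs n S) = 0\<^sub>m n n"
  "Module.smult (mat_vs n S) = (\<cdot>\<^sub>m)"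
  by (simp_all add: module_mat_def)

lemma vectorspace_mat_vs:
  assumes "mat_subspace n S"
  shows "vectorspace class_ring (mat_vs n S)"
  using vectorspace.subspace_is_vs[OF matrix_vs] assms by (auto simp: mat_subspace_def)

lemma linear_mapI:
  assumes "vectorspace class_ring V" "vectorspace class_ring W"
    and "\<And>v. v \<in> carrier V \<Longrightarrow> f v \<in> carrier W"
    and "\<And>v w. v \<in> carrier V \<Longrightarrow> w \<in> carrier V \<Longrightarrow> f (v \<oplus>\<^bsub>V\<^esub> w) = f v \<oplus>\<^bsub>W\<^esub> f w"
    and "\<And>c v. v \<in> carrier V \<Longrightarrow> f (c \<odot>\<^bsub>V\<^esub> v) = c \<odot>\<^bsub>W\<^esub> f v"
  shows "linear_map (class_ring :: 'a::field ring) V W f"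
  using assms unfolding linear_map_def mod_hom_def mod_hom_axioms_def LinearCombinations.module_hom_def
  by (auto simp: vectorspace_def)

lemma vec_dim: "vectorspace.dim class_ring (module_vec TYPE('a::field) n) = n"
  using vec_space.dim_is_n[where 'a='a] .

lemma vec_fin_dim: "vectorspace.fin_dim class_ring (module_vec TYPE('a::field) n)"
  using vec_space.fin_dim[where 'a='a] .

text \<open>
Reading off the entries of a matrix row by row identifies it with a vector of length \<open>n * n\<close>.
\<close>
lemma mat_fin_dim: "vectorspace.fin_dim class_ring (module_mat TYPE('a::field) n n)"
proof -
  let ?f = "\<lambda>v :: 'a vec. mat n n (\<lambda>(i,j). v $ (i * n + j))"
  have bd: "i * n + j < n * n" if "i < n" "j < n" for i j
    using that by (metis mod_div_trivial mod_less mod_mult_self3 div_less less_mult_imp_div_less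
        div_mult_self3 add.commute add_cancel_right_right div_less_iff_less_mult gr_implies_not0 neq0_conv)
  interpret linear_map class_ring "module_vec TYPE('a) (n * n)" "module_mat TYPE('a) n n" ?f
    by (rule linear_mapI) (auto simp: matrix_vs vec_vs matrix_vs_simps module_vec_simps bd)
  have "M \<in> ?f ` carrier_vec (n * n)" if "M \<in> carrier_mat n n" for M
  proof (rule image_eqI)
    show "M = ?f (vec (n * n) (\<lambda>k. M $$ (k div n, k mod n)))"
      using that by (intro eq_matI) (auto simp: bd)
  qed auto
  then show ?thesis
    by (intro surj_fin_dim[OF vec_fin_dim]) (auto simp: module_vec_simps matrix_vs_simps)
qed

lemma mat_vs_fin_dim:
  assumes "mat_subspace n S"
  shows "vectorspace.fin_dim class_ring (mat_vs n S)"
  using vectorspace.subspace_fin_dim[OF matrix_vs mat_fin_dim] assms by (auto simp: mat_subspace_def)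

lemma mat_subspace_nested:
  assumes "mat_subspace n S" "mat_subspace n T" "S \<subseteq> T"
  shows "VectorSpace.subspace class_ring S (mat_vs n T)"
  using vectorspace.nested_subspaces[OF matrix_vs] assms by (auto simp: mat_subspace_def)

lemma mat_subspace_dim_mono:
  assumes "mat_subspace n S" "mat_subspace n T" "S \<subseteq> T"
  shows "mat_subspace_dim n S \<le> mat_subspace_dim n T"
  using vectorspace.subspace_dim[OF vectorspace_mat_vs mat_subspace_nested mat_vs_fin_dim,
      of n T S] assms
  by (simp add: mat_subspace_dim_def mat_vs_fin_dim)

lemma mat_subspace_dim_eq_imp_eq:
  assumes "mat_subspace n S" "mat_subspace n T" "S \<subseteq> T"
    and "mat_subspace_dim n S = mat_subspace_dim n T"
  shows "S = T"
  using vectorspace.subspace_dim_eq_imp_full[OF vectorspace_mat_vs mat_vs_fin_dim mat_subspace_nested,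
      of n T S] assms
  by (simp add: mat_subspace_dim_def)

lemma mat_rank_nullity:
  assumes S: "mat_subspace n (S :: 'a::field mat set)"
    and f: "\<And>A. A \<in> S \<Longrightarrow> f A \<in> carrier_mat m m"
    and add: "\<And>A B. A \<in> S \<Longrightarrow> B \<in> S \<Longrightarrow> f (A + B) = f A + f B"
    and smult: "\<And>c A. A \<in> S \<Longrightarrow> f (c \<cdot>\<^sub>m A) = c \<cdot>\<^sub>m f A"
  shows "mat_subspace_dim n S =
    mat_subspace_dim m (f ` S) + mat_subspace_dim n {A \<in> S. f A = 0\<^sub>m m m}"
proof -
  interpret linear_map class_ring "mat_vs n S" "module_mat TYPE('a) m m" f
    by (rule linear_mapI)
      (auto simp: matrix_vs vectorspace_mat_vs[OF S] mat_vs_simps matrix_vs_simps f add smult)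
  show ?thesis
    using rank_nullity[OF mat_vs_fin_dim[OF S]]
    by (simp add: mat_subspace_dim_def im_def ker_def mat_vs_simps matrix_vs_simps)
qed

lemma mat_subspace_dim_bij:
  assumes S: "mat_subspace n (S :: 'a::field mat set)" and T: "mat_subspace m T"
    and f: "bij_betw f S T"
    and add: "\<And>A B. A \<in> S \<Longrightarrow> B \<in> S \<Longrightarrow> f (A + B) = f A + f B"
    and smult: "\<And>c A. A \<in> S \<Longrightarrow> f (c \<cdot>\<^sub>m A) = c \<cdot>\<^sub>m f A"
  shows "mat_subspace_dim n S = mat_subspace_dim m T"
proof -
  interpret linear_map class_ring "mat_vs n S" "mat_vs m T" f
    using f by (intro linear_mapI)
      (auto simp: vectorspace_mat_vs[OF S] vectorspace_mat_vs[OF T] mat_vs_simps add smult bij_betw_def)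
  show ?thesis
    using dim_eq[OF mat_vs_fin_dim[OF S]] f
    by (simp add: mat_subspace_dim_def mat_vs_simps bij_betw_def)
qed

lemma mat_subspace_dim_vec:
  assumes S: "mat_subspace n (S :: 'a::field mat set)"
    and f: "bij_betw f (carrier_vec d) S"
    and add: "\<And>v w. v \<in> carrier_vec d \<Longrightarrow> w \<in> carrier_vec d \<Longrightarrow> f (v + w) = f v + f w"
    and smult: "\<And>c v. v \<in> carrier_vec d \<Longrightarrow> f (c \<cdot>\<^sub>v v) = c \<cdot>\<^sub>m f v"
  shows "mat_subspace_dim n S = d"
proof -
  interpret linear_map class_ring "module_vec TYPE('a) d" "mat_vs n S" f
    using f by (intro linear_mapI)
      (auto simp: vectorspace_mat_vs[OF S] vec_vs mat_vs_simps module_vec_simps add smult bij_betw_def)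
  show ?thesis
    using dim_eq[OF vec_fin_dim] f
    by (simp add: mat_subspace_dim_def mat_vs_simps module_vec_simps bij_betw_def vec_dim)
qed

section \<open>Straightening a subspace by a change of basis\<close>

definition coord_space :: "nat \<Rightarrow> nat \<Rightarrow> 'a::field vec set" where
  "coord_space n a = {v \<in> carrier_vec n. \<forall>i. a \<le> i \<and> i < n \<longrightarrow> v $ i = 0}"

text \<open>
Extending a basis of \<open>W\<close> to a basis of the whole space yields an invertible matrix \<open>Q\<close> whose first
\<open>a\<close> columns span \<open>W\<close>; its inverse \<open>P\<close> sends \<open>W\<close> onto the span of the first \<open>a\<close> coordinate vectors.
\<close>
lemma subspace_straighten:
  assumes W: "VectorSpace.subspace class_ring W (module_vec TYPE('a::field) n)"
  obtains a P Q where "a \<le> n" "P \<in> carrier_mat n n" "Q \<in> carrier_mat n n"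
    "P * Q = 1\<^sub>m n" "Q * P = 1\<^sub>m n" "W = {w \<in> carrier_vec n. P *\<^sub>v w \<in> coord_space n a}"
proof -
  interpret V: vec_space "TYPE('a)" n .
  have sub: "LinearCombinations.submodule class_ring W V.V" and WV: "W \<subseteq> carrier_vec n"
    using W by (auto simp: VectorSpace.subspace_def LinearCombinations.submodule_def module_vec_simps)
  interpret W: vectorspace class_ring "V.vs W"
    using W by (rule V.subspace_is_vs)
  obtain \<beta> where \<beta>: "finite \<beta>" "W.basis \<beta>"
    using W.finite_basis_exists V.subspace_fin_dim[OF V.fin_dim W] by blast
  have \<beta>W: "\<beta> \<subseteq> W" and "W.lin_indpt \<beta>" and "W.span \<beta> = W"
    using \<beta> by (auto simp: W.basis_def)
  then have li: "V.lin_indpt \<beta>" and span: "V.span \<beta> = W"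
    using V.span_li_not_depend[OF \<beta>W sub] by simp_all
  have \<beta>V: "\<beta> \<subseteq> carrier_vec n" using \<beta>W WV by blast
  let ?U = "set (unit_vecs n) :: 'a vec set"
  have spanU: "V.span ?U = carrier_vec n" by (rule V.span_unit_vecs_is_carrier)
  have cardU: "card ?U = n"
    using V.unit_vecs_distinct distinct_card by fastforce
  obtain C where C: "finite C" "C \<subseteq> carrier_vec n" "C \<inter> \<beta> = {}"
    "int (card C) \<le> int (card ?U) - int (card \<beta>)" "V.span (\<beta> \<union> C) = carrier_vec n"
    using V.replacement[OF \<beta>(1) _ _ li, of ?U] \<beta>V spanU by (auto simp: unit_vecs_carrier)
  have le: "card (\<beta> \<union> C) \<le> n"
    using C \<beta> cardU by (simp add: card_Un_disjoint inf_commute)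
  then have basis: "V.basis (\<beta> \<union> C)"
    using V.dim_gen_is_basis[of "\<beta> \<union> C"] C \<beta> \<beta>V by (simp add: V.dim_is_n)
  then have card: "card (\<beta> \<union> C) = n"
    using V.dim_basis[of "\<beta> \<union> C"] C \<beta> by (simp add: V.dim_is_n)
  obtain xs where xs: "set xs = \<beta>" "distinct xs" using finite_distinct_list \<beta>(1) by blast
  obtain ys where ys: "set ys = C" "distinct ys" using finite_distinct_list C(1) by blast
  define a where "a = length xs"
  have len: "length (xs @ ys) = n"
    using xs ys C card by (metis distinct_append distinct_card inf_commute set_append)
  define Q where "Q = mat_of_cols n (xs @ ys)"
  have Q: "Q \<in> carrier_mat n n" unfolding Q_def using len by auto
  have colsQ: "cols Q = xs @ ys"
    unfolding Q_def using xs ys \<beta>V C by (intro cols_mat_of_cols) auto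
  have dist: "distinct (cols Q)" using xs ys C colsQ by auto
  have colQ: "col Q i = (xs @ ys) ! i" if "i < n" for i
    using that colsQ Q by (metis carrier_matD(2) cols_nth)
  have "V.rank Q = n"
    using V.lin_indpt_full_rank[OF Q dist] basis xs ys colsQ by (simp add: V.basis_def)
  then have "det Q \<noteq> 0" using V.det_rank_iff[OF Q] by simp
  then obtain P where P: "P \<in> carrier_mat n n" "P * Q = 1\<^sub>m n" "Q * P = 1\<^sub>m n"
    using det_non_zero_imp_unit[OF Q, of "()"] by (auto simp: Units_def ring_mat_def)
  have a: "a \<le> n" using len a_def by simp
  have lc: "Q *\<^sub>v vec n (\<lambda>i. c (col Q i)) = V.lincomb c \<beta>" if "\<And>v. v \<in> C \<Longrightarrow> c v = 0" for c
  proof -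
    have "Q *\<^sub>v vec n (\<lambda>i. c (col Q i)) = V.lincomb c (\<beta> \<union> C)"
      using V.mat_mult_eq_lincomb[OF Q dist, of c] colsQ xs ys by simp
    also have "\<dots> = V.lincomb c \<beta> + V.lincomb c C"
      using V.lincomb_union[of \<beta> C c] \<beta> C \<beta>V by (auto simp: inf_commute)
    also have "V.lincomb c C = 0\<^sub>v n"
      using V.lincomb_zero[of C c] that C by auto
    finally show ?thesis using \<beta>V by simp
  qed
  have "w \<in> W \<longleftrightarrow> P *\<^sub>v w \<in> coord_space n a" if w: "w \<in> carrier_vec n" for w
  proof
    assume "w \<in> W"
    then obtain c where c: "w = V.lincomb c \<beta>"
      using span V.finite_in_span[OF \<beta>(1)] \<beta>V by auto
    define d where "d = (\<lambda>v. if v \<in> \<beta> then c v else 0)"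
    have "w = V.lincomb d \<beta>"
      unfolding c by (rule V.lincomb_cong) (use \<beta>V in \<open>auto simp: d_def\<close>)
    also have "\<dots> = Q *\<^sub>v vec n (\<lambda>i. d (col Q i))"
      by (rule lc[symmetric]) (use C in \<open>auto simp: d_def\<close>)
    finally have "P *\<^sub>v w = (P * Q) *\<^sub>v vec n (\<lambda>i. d (col Q i))"
      using P Q by (metis assoc_mult_mat_vec vec_carrier)
    then have "P *\<^sub>v w = vec n (\<lambda>i. d (col Q i))" using P by simp
    moreover have "d (col Q i) = 0" if "a \<le> i" "i < n" for i
    proof -
      have "(xs @ ys) ! i \<in> C"
        using that ys len a_def by (auto simp: nth_append)
      then show ?thesis using C colQ that by (auto simp: d_def)
    qed
    ultimately show "P *\<^sub>v w \<in> coord_space n a" by (auto simp: coord_space_def)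
  next
    assume u: "P *\<^sub>v w \<in> coord_space n a"
    \<comment> \<open>The columns of \<open>Q\<close> are distinct, so a function on columns can list the coordinates of \<open>P *\<^sub>v w\<close>.\<close>
    define c where "c v = (P *\<^sub>v w) $ (SOME i. i < n \<and> col Q i = v)" for v
    have some: "(SOME j. j < n \<and> col Q j = col Q i) = i" if "i < n" for i
    proof (rule some_equality)
      fix j assume "j < n \<and> col Q j = col Q i"
      then show "j = i"
        using that dist colsQ colQ len by (metis nth_eq_iff_index_eq)
    qed (use that in auto)
    have eq: "vec n (\<lambda>i. c (col Q i)) = P *\<^sub>v w"
      using P w some by (intro eq_vecI) (auto simp: c_def)
    have c0: "c v = 0" if v: "v \<in> C" for v
    proof -
      obtain k where k: "k < length ys" "v = ys ! k"
        using v ys by (metis in_set_conv_nth)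
      then have "a + k < n" "col Q (a + k) = v"
        using len colQ[of "a + k"] by (auto simp: a_def)
      then show ?thesis
        using u some[of "a + k"] by (auto simp: c_def coord_space_def)
    qed
    have "w = Q *\<^sub>v (P *\<^sub>v w)"
      using P Q w by (metis assoc_mult_mat_vec one_mult_mat_vec)
    also have "\<dots> = V.lincomb c \<beta>" using lc[of c] c0 eq by simp
    finally show "w \<in> W"
      using span V.finite_span[OF \<beta>(1)] \<beta>V by auto
  qed
  then show ?thesis using that[OF a P(1) Q P(2,3)] WV by blast
qed

section \<open>Block upper triangular matrices\<close>

definition block_upper :: "nat \<Rightarrow> nat \<Rightarrow> 'a::field mat \<Rightarrow> bool" where
  "block_upper a n M \<longleftrightarrow> M \<in> carrier_mat n n \<and> (\<forall>r c. a \<le> r \<and> r < n \<and> c < a \<longrightarrow> M $$ (r, c) = 0)"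

definition diag_block :: "nat \<Rightarrow> nat \<Rightarrow> 'a::field mat \<Rightarrow> 'a mat" where
  "diag_block i k M = mat k k (\<lambda>(r, c). M $$ (i + r, i + c))"

lemma diag_block_carrier [simp]: "diag_block i k M \<in> carrier_mat k k"
  by (simp add: diag_block_def)

lemma diag_block_dims [simp]: "dim_row (diag_block i k M) = k" "dim_col (diag_block i k M) = k"
  by (simp_all add: diag_block_def)

lemma diag_block_index [simp]:
  "r < k \<Longrightarrow> c < k \<Longrightarrow> diag_block i k M $$ (r, c) = M $$ (i + r, i + c)"
  by (simp add: diag_block_def)

lemma diag_block_diag_block:
  "j + l \<le> k \<Longrightarrow> diag_block j l (diag_block i k M) = diag_block (i + j) l M"
  by (rule eq_matI) (auto simp: add.assoc)

lemma diag_block_whole: "M \<in> carrier_mat n n \<Longrightarrow> diag_block 0 n M = M"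
  by (rule eq_matI) auto

lemma diag_block_add:
  "M \<in> carrier_mat n n \<Longrightarrow> N \<in> carrier_mat n n \<Longrightarrow> i + k \<le> n \<Longrightarrow>
    diag_block i k (M + N) = diag_block i k M + diag_block i k N"
  by (rule eq_matI) auto

lemma diag_block_smult:
  "M \<in> carrier_mat n n \<Longrightarrow> i + k \<le> n \<Longrightarrow> diag_block i k (c \<cdot>\<^sub>m M) = c \<cdot>\<^sub>m diag_block i k M"
  by (rule eq_matI) auto

lemma diag_block_zero [simp]: "i + k \<le> n \<Longrightarrow> diag_block i k (0\<^sub>m n n) = 0\<^sub>m k k"
  by (rule eq_matI) auto

lemma diag_block_one [simp]: "i + k \<le> n \<Longrightarrow> diag_block i k (1\<^sub>m n) = 1\<^sub>m k"
  by (rule eq_matI) auto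

lemma block_upper_four_block:
  assumes "A \<in> carrier_mat a a" "B \<in> carrier_mat b b" "C \<in> carrier_mat a b"
  shows "block_upper a (a + b) (four_block_mat A C (0\<^sub>m b a) B)"
    "diag_block 0 a (four_block_mat A C (0\<^sub>m b a) B) = A"
    "diag_block a b (four_block_mat A C (0\<^sub>m b a) B) = B"
  using assms by (auto simp: block_upper_def intro!: eq_matI)

lemma block_upper_eq_four_block:
  assumes "block_upper a (a + b) M"
  shows "M = four_block_mat (diag_block 0 a M) (mat a b (\<lambda>(r, c). M $$ (r, a + c)))
               (0\<^sub>m b a) (diag_block a b M)"
  using assms by (intro eq_matI) (auto simp: block_upper_def)

lemma block_upper_mult:
  assumes X: "block_upper a (a + b) X" and Y: "block_upper a (a + b) Y"
  shows "block_upper a (a + b) (X * Y)"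
    "diag_block 0 a (X * Y) = diag_block 0 a X * diag_block 0 a Y"
    "diag_block a b (X * Y) = diag_block a b X * diag_block a b Y"
proof -
  let ?C = "\<lambda>M. mat a b (\<lambda>(r, c). M $$ (r, a + c)) :: 'a mat"
  let ?D = "diag_block 0 a X * ?C Y + ?C X * diag_block a b Y"
  have "X * Y = four_block_mat (diag_block 0 a X) (?C X) (0\<^sub>m b a) (diag_block a b X)
     * four_block_mat (diag_block 0 a Y) (?C Y) (0\<^sub>m b a) (diag_block a b Y)"
    using block_upper_eq_four_block[OF X] block_upper_eq_four_block[OF Y] by simp
  also have "\<dots> = four_block_mat (diag_block 0 a X * diag_block 0 a Y) ?D
      (0\<^sub>m b a) (diag_block a b X * diag_block a b Y)"
    by (subst mult_four_block_mat[where ?nr1.0 = a and ?n1.0 = a and ?n2.0 = b and ?nr2.0 = b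
          and ?nc1.0 = a and ?nc2.0 = b])
       (auto intro!: cong_four_block_mat right_add_zero_mat[of _ a a] left_add_zero_mat[of _ b b]
          simp: mult_carrier_mat[of _ a a] mult_carrier_mat[of _ b b])
  finally have *: "X * Y = \<dots>" .
  have c: "diag_block 0 a X * diag_block 0 a Y \<in> carrier_mat a a" 
    "diag_block a b X * diag_block a b Y \<in> carrier_mat b b" "?D \<in> carrier_mat a b"
    by (auto intro!: mult_carrier_mat add_carrier_mat diag_block_carrier)
  show "block_upper a (a + b) (X * Y)"
    "diag_block 0 a (X * Y) = diag_block 0 a X * diag_block 0 a Y"
    "diag_block a b (X * Y) = diag_block a b X * diag_block a b Y"
    unfolding * using block_upper_four_block[OF c] by auto
qed

lemma char_poly_block_upper:
  assumes M: "block_upper a (a + b) M"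
  shows "char_poly M = char_poly (diag_block 0 a M) * char_poly (diag_block a b M)"
proof -
  have "M \<in> carrier_mat (a + b) (a + b)" using M by (simp add: block_upper_def)
  then have "char_poly_matrix M = four_block_mat (char_poly_matrix (diag_block 0 a M))
     (mat a b (\<lambda>(r, c). [:- (M $$ (r, a + c)):])) (0\<^sub>m b a) (char_poly_matrix (diag_block a b M))"
    using M by (intro eq_matI) (auto simp: char_poly_matrix_def block_upper_def)
  then show ?thesis
    unfolding char_poly_def
    by (simp add: det_four_block_mat_lower_left_zero[of _ a _ b])
qed

lemma block_upper_iff_coord_space_invariant:
  fixes M :: "'a::field mat"
  assumes M: "M \<in> carrier_mat n n" and "a \<le> n"
  shows "block_upper a n M \<longleftrightarrow> (\<forall>v\<in>coord_space n a. M *\<^sub>v v \<in> coord_space n a)"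
proof safe
  fix v :: "'a vec" assume b: "block_upper a n M" and v: "v \<in> coord_space n a"
  have "(M *\<^sub>v v) $ r = 0" if r: "a \<le> r" "r < n" for r
  proof -
    have "(M *\<^sub>v v) $ r = (\<Sum>c<n. M $$ (r, c) * v $ c)"
      using M v r by (auto simp: scalar_prod_def coord_space_def atLeast0LessThan intro!: sum.cong)
    also have "\<dots> = 0"
    proof (rule sum.neutral, intro ballI)
      fix c assume "c \<in> {..<n}"
      then show "M $$ (r, c) * v $ c = 0"
        using b v r by (cases "c < a") (auto simp: block_upper_def coord_space_def)
    qed
    finally show ?thesis .
  qed
  then show "M *\<^sub>v v \<in> coord_space n a"
    using M v by (auto simp: coord_space_def)
next
  assume inv: "\<forall>v\<in>coord_space n a. M *\<^sub>v v \<in> coord_space n a"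
  have "M $$ (r, c) = 0" if "a \<le> r" "r < n" "c < a" for r c
  proof -
    have "M *\<^sub>v unit_vec n c \<in> coord_space n a"
      using inv that by (auto simp: coord_space_def unit_vec_def)
    moreover have "(M *\<^sub>v unit_vec n c) $ r = M $$ (r, c)"
      using that M \<open>a \<le> n\<close> by auto
    ultimately show ?thesis
      using that by (auto simp: coord_space_def)
  qed
  then show "block_upper a n M" using M by (simp add: block_upper_def)
qed

lemma block_upper_conj:
  assumes PQ: "P \<in> carrier_mat n n" "Q \<in> carrier_mat n n" "P * Q = 1\<^sub>m n"
    and M: "M \<in> carrier_mat n n" and "a \<le> n"
    and inv: "\<And>w. w \<in> carrier_vec n \<Longrightarrow> P *\<^sub>v w \<in> coord_space n a \<Longrightarrow> P *\<^sub>v (M *\<^sub>v w) \<in> coord_space n a"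
  shows "block_upper a n (P * M * Q)"
proof -
  have "P * M * Q *\<^sub>v v \<in> coord_space n a" if v: "v \<in> coord_space n a" for v
  proof -
    have vn: "v \<in> carrier_vec n" using v by (simp add: coord_space_def)
    have "P *\<^sub>v (Q *\<^sub>v v) = v"
      using PQ vn by (metis assoc_mult_mat_vec one_mult_mat_vec)
    then have "P *\<^sub>v (M *\<^sub>v (Q *\<^sub>v v)) \<in> coord_space n a"
      using inv[of "Q *\<^sub>v v"] PQ vn v by simp
    moreover have "P * M * Q *\<^sub>v v = P *\<^sub>v (M *\<^sub>v (Q *\<^sub>v v))"
      using PQ M vn by (simp add: assoc_mult_mat_vec[of _ n n _ n] mult_carrier_mat[of _ n n])
    ultimately show ?thesis by simp
  qed
  moreover have "P * M * Q \<in> carrier_mat n n" using PQ M by auto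
  ultimately show ?thesis
    using block_upper_iff_coord_space_invariant \<open>a \<le> n\<close> by blast
qed

section \<open>Triangularizability and split characteristic polynomials\<close>

text \<open>
Every root of the product is a root of one of the factors, so the linear factors can be divided out
one at a time; in the end \<open>p\<close> is a unit with leading coefficient 1.
\<close>
lemma linear_factors_of_factor:
  fixes p q :: "'a::field poly"
  assumes "p * q = (\<Prod>a\<leftarrow>as. [:- a, 1:])" "lead_coeff p = 1"
  shows "\<exists>bs. p = (\<Prod>a\<leftarrow>bs. [:- a, 1:])"
  using assms
proof (induction as arbitrary: p q)
  case Nil
  then have "p dvd 1" by (metis dvd_triv_left list.simps(8) prod_list.Nil)
  then obtain c where "p = [:c:]" by (auto simp: poly_dvd_1 elim: degree_eq_zeroE)
  then have "p = 1" using Nil by simp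
  then show ?case by (intro exI[of _ "[]"]) simp
next
  case (Cons a as)
  have "poly (p * q) a = 0" unfolding Cons.prems by simp
  then consider "poly p a = 0" | "poly q a = 0" by auto
  then show ?case
  proof cases
    case 1
    then obtain r where r: "p = [:- a, 1:] * r" by (metis poly_eq_0_iff_dvd dvdE)
    have "[:- a, 1:] * (r * q) = [:- a, 1:] * (\<Prod>a\<leftarrow>as. [:- a, 1:])"
      using Cons.prems(1) unfolding r by (simp only: mult.assoc list.map prod_list.Cons)
    then have "r * q = (\<Prod>a\<leftarrow>as. [:- a, 1:])"
      by (subst (asm) mult_cancel_left) simp
    moreover have "lead_coeff r = 1" using Cons.prems(2) unfolding r lead_coeff_mult by simp
    ultimately obtain bs where "r = (\<Prod>a\<leftarrow>bs. [:- a, 1:])" using Cons.IH by blast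
    then show ?thesis unfolding r by (intro exI[of _ "a # bs"]) simp
  next
    case 2
    then obtain r where r: "q = [:- a, 1:] * r" by (metis poly_eq_0_iff_dvd dvdE)
    have "[:- a, 1:] * (p * r) = [:- a, 1:] * (\<Prod>a\<leftarrow>as. [:- a, 1:])"
      using Cons.prems(1) unfolding r by (simp only: mult.left_commute list.map prod_list.Cons)
    then have "p * r = (\<Prod>a\<leftarrow>as. [:- a, 1:])"
      by (subst (asm) mult_cancel_left) simp
    then show ?thesis using Cons by blast
  qed
qed

lemma similar_mat_carrier:
  assumes "similar_mat A B" "A \<in> carrier_mat n n"
  shows "B \<in> carrier_mat n n"
proof -
  obtain m where "A \<in> carrier_mat m m" "B \<in> carrier_mat m m"
    using similar_matD[OF assms(1)] by blast
  then show ?thesis using assms(2) by (metis carrier_matD(1))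
qed

lemma triangularizable_similar:
  "similar_mat A B \<Longrightarrow> triangularizable B \<Longrightarrow> triangularizable A"
  unfolding triangularizable_def using similar_mat_trans by blast

lemma triangularizable_block_upper:
  assumes M: "block_upper a (a + b) M"
    and "triangularizable (diag_block 0 a M)" "triangularizable (diag_block a b M)"
  shows "triangularizable M"
proof -
  obtain T1 T2 where T1: "similar_mat (diag_block 0 a M) T1" "upper_triangular T1"
    and T2: "similar_mat (diag_block a b M) T2" "upper_triangular T2"
    using assms by (auto simp: triangularizable_def)
  have "T1 \<in> carrier_mat a a" "T2 \<in> carrier_mat b b"
    using similar_mat_carrier T1 T2 diag_block_carrier by blast+
  obtain C where "similar_mat M (four_block_mat T1 C (0\<^sub>m b a) T2)"
    using similar_mat_four_block_0_ex[OF T1(1) T2(1), of "mat a b (\<lambda>(r, c). M $$ (r, a + c))" a b]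
      block_upper_eq_four_block[OF M] by auto
  moreover have "upper_triangular (four_block_mat T1 C (0\<^sub>m b a) T2)"
    by (rule upper_triangular_four_block) fact+
  ultimately show ?thesis by (auto simp: triangularizable_def)
qed

lemma triangularizable_imp_splits:
  assumes "triangularizable M" "M \<in> carrier_mat n n"
  shows "\<exists>as. char_poly M = (\<Prod>a\<leftarrow>as. [:- a, 1:])"
proof -
  obtain T where T: "similar_mat M T" "upper_triangular T"
    using assms by (auto simp: triangularizable_def)
  then have "T \<in> carrier_mat n n" using similar_mat_carrier assms(2) by blast
  then show ?thesis
    using char_poly_similar[OF T(1)] char_poly_upper_triangular T(2) by metis
qed

lemma block_upper_splits:
  assumes M: "block_upper a (a + b) M" and "char_poly M = (\<Prod>a\<leftarrow>as. [:- a, 1:])"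
  shows "\<exists>bs. char_poly (diag_block 0 a M) = (\<Prod>a\<leftarrow>bs. [:- a, 1:])"
    "\<exists>bs. char_poly (diag_block a b M) = (\<Prod>a\<leftarrow>bs. [:- a, 1:])"
proof -
  have "lead_coeff (char_poly (diag_block i k M)) = 1" for i k
    using degree_monic_char_poly[of "diag_block i k M" k] by simp
  then show "\<exists>bs. char_poly (diag_block 0 a M) = (\<Prod>a\<leftarrow>bs. [:- a, 1:])"
    "\<exists>bs. char_poly (diag_block a b M) = (\<Prod>a\<leftarrow>bs. [:- a, 1:])"
    using char_poly_block_upper[OF M] assms(2) linear_factors_of_factor
    by (metis, metis mult.commute)
qed

text \<open>
An eigenvector \<open>v\<close> spans an invariant line, which is a proper nonzero subspace when \<open>2 \<le> n\<close>.
Straightening this line makes the matrix block upper triangular with two smaller diagonal blocks.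
Their characteristic polynomials divide the split one of the matrix, so induction triangularizes
both blocks. The size \<open>a\<close> of the first block is only known to satisfy \<open>0 < a < n\<close>, which suffices.
\<close>
lemma splits_imp_triangularizable:
  assumes "M \<in> carrier_mat n n" "char_poly M = (\<Prod>a\<leftarrow>as. [:- a, 1:])"
  shows "triangularizable M"
  using assms
proof (induction n arbitrary: M as rule: less_induct)
  case (less n)
  note M = less.prems(1)
  show ?case
  proof (cases "n \<le> 1")
    case True
    then have "upper_triangular M" using M by (auto simp: upper_triangular_def)
    then show ?thesis using similar_mat_refl[OF M] by (auto simp: triangularizable_def)
  next
    case False
    obtain e es where "as = e # es"
      using degree_monic_char_poly[OF M] less.prems(2) False by (cases as) auto
    then have "poly (char_poly M) e = 0" using less.prems(2) by simp
    then obtain v where v: "v \<in> carrier_vec n" "v \<noteq> 0\<^sub>v n" "M *\<^sub>v v = e \<cdot>\<^sub>v v"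
      using eigenvalue_root_char_poly[OF M] M by (auto simp: eigenvalue_def eigenvector_def)
    define W where "W = range (\<lambda>c. c \<cdot>\<^sub>v v)"
    have "VectorSpace.subspace class_ring W (module_vec TYPE('a) n)"
      unfolding vec_subspace_iff
    proof (intro conjI ballI allI)
      show "W \<subseteq> carrier_vec n" using v by (auto simp: W_def)
      show "0\<^sub>v n \<in> W" using v by (auto simp: W_def intro!: image_eqI[of _ _ 0])
      show "x + y \<in> W" if "x \<in> W" "y \<in> W" for x y
        using that v by (auto simp: W_def add_smult_distrib_vec[symmetric])
      show "c \<cdot>\<^sub>v x \<in> W" if "x \<in> W" for c x
        using that v by (auto simp: W_def smult_smult_assoc)
    qed
    then obtain a P Q where a: "a \<le> n" and PQ: "P \<in> carrier_mat n n" "Q \<in> carrier_mat n n"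
      "P * Q = 1\<^sub>m n" "Q * P = 1\<^sub>m n" and W: "W = {w \<in> carrier_vec n. P *\<^sub>v w \<in> coord_space n a}"
      by (rule subspace_straighten)
    have "v \<in> W" by (auto simp: W_def intro!: image_eqI[of _ _ 1])
    have "a \<noteq> 0"
    proof
      assume "a = 0"
      then have "P *\<^sub>v v = 0\<^sub>v n" using \<open>v \<in> W\<close> W PQ by (intro eq_vecI) (auto simp: coord_space_def)
      then have "Q *\<^sub>v (P *\<^sub>v v) = 0\<^sub>v n" using PQ by (intro eq_vecI) (auto simp: scalar_prod_def)
      then show False using v PQ by (metis assoc_mult_mat_vec one_mult_mat_vec)
    qed
    moreover have "a \<noteq> n"
    proof
      assume "a = n"
      then have "unit_vec n 0 \<in> W" "unit_vec n 1 \<in> W" using W PQ by (auto simp: coord_space_def)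
      then obtain c d where c: "unit_vec n 0 = c \<cdot>\<^sub>v v" and d: "unit_vec n 1 = d \<cdot>\<^sub>v v"
        by (auto simp: W_def)
      \<comment> \<open>Two distinct unit vectors are not multiples of one vector.\<close>
      have "c * v $ 0 = 1" "c * v $ 1 = 0" "d * v $ 0 = 0" "d * v $ 1 = 1"
        using arg_cong[OF c, of "\<lambda>x. x $ 0"] arg_cong[OF c, of "\<lambda>x. x $ 1"]
          arg_cong[OF d, of "\<lambda>x. x $ 0"] arg_cong[OF d, of "\<lambda>x. x $ 1"] v False by auto
      then show False by auto
    qed
    ultimately have a: "0 < a" "a < n" using a by auto
    define b where "b = n - a"
    have n: "n = a + b" using a by (simp add: b_def)
    let ?N = "P * M * Q"
    have N: "?N \<in> carrier_mat n n" using PQ M by auto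
    have "similar_mat M ?N"
    proof (rule similar_matI)
      have "Q * ?N * P = (Q * P) * M * (Q * P)"
        using PQ(1,2) M by (simp add: assoc_mult_mat[of _ n n _ n _ n] mult_carrier_mat[of _ n n])
      then show "M = Q * ?N * P" using PQ M by simp
    qed (use PQ M N in auto)
    have "M *\<^sub>v w \<in> W" if "w \<in> W" for w
      using that v M by (auto simp: W_def mult_mat_vec smult_smult_assoc)
    then have "block_upper a n ?N"
      using block_upper_conj[OF PQ(1-3) M, of a] a W by auto
    then have bu: "block_upper a (a + b) ?N" using n by simp
    have "char_poly ?N = (\<Prod>a\<leftarrow>as. [:- a, 1:])"
      using char_poly_similar[OF \<open>similar_mat M ?N\<close>] less.prems(2) by simp
    from block_upper_splits[OF bu this] have "triangularizable (diag_block 0 a ?N)"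
        "triangularizable (diag_block a b ?N)"
      using less.IH[of a "diag_block 0 a ?N"] less.IH[of b "diag_block a b ?N"] a n by auto
    then have "triangularizable ?N"
      using triangularizable_block_upper[OF bu] by blast
    then show ?thesis using triangularizable_similar \<open>similar_mat M ?N\<close> by blast
  qed
qed

text \<open>
From the matrix to its blocks the argument goes through characteristic polynomials: a triangularizing
basis of the matrix need not contain a basis of the invariant subspace, whereas a factor of a split
polynomial splits.
\<close>
lemma triangularizable_block_upper_iff:
  assumes M: "block_upper a (a + b) M"
  shows "triangularizable M \<longleftrightarrow>
    triangularizable (diag_block 0 a M) \<and> triangularizable (diag_block a b M)"
proof
  assume "triangularizable M"
  then obtain as where "char_poly M = (\<Prod>a\<leftarrow>as. [:- a, 1:])"
    using triangularizable_imp_splits M unfolding block_upper_def by blast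
  from block_upper_splits[OF M this]
  show "triangularizable (diag_block 0 a M) \<and> triangularizable (diag_block a b M)"
    using splits_imp_triangularizable diag_block_carrier by blast
qed (use triangularizable_block_upper[OF M] in blast)

section \<open>Similar sets of matrices\<close>

lemma mat_conj_cancel:
  fixes P Q M :: "'a::field mat"
  assumes "P \<in> carrier_mat n n" "Q \<in> carrier_mat n n" "Q * P = 1\<^sub>m n" "M \<in> carrier_mat n n"
  shows "Q * (P * M * Q) * P = M"
proof -
  have "Q * (P * M * Q) * P = (Q * P) * M * (Q * P)"
    using assms(1,2,4) by (simp add: assoc_mult_mat[of _ n n _ n _ n] mult_carrier_mat[of _ n n])
  then show ?thesis using assms by simp
qed

lemma similar_sets_refl: "S \<subseteq> carrier_mat n n \<Longrightarrow> similar_sets n S S"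
proof -
  assume S: "S \<subseteq> carrier_mat n n"
  have "(\<lambda>A. 1\<^sub>m n * A * 1\<^sub>m n) ` S = (\<lambda>A. A) ` S"
  proof (rule image_cong)
    fix A assume "A \<in> S"
    then have "A \<in> carrier_mat n n" using S by blast
    then show "1\<^sub>m n * A * 1\<^sub>m n = A" by simp
  qed simp
  then show ?thesis unfolding similar_sets_def by (intro exI[of _ "1\<^sub>m n"]) simp
qed

lemma similar_sets_sym:
  assumes "S \<subseteq> carrier_mat n n" "similar_sets n S T"
  shows "similar_sets n T S"
proof -
  obtain P Q where PQ: "P \<in> carrier_mat n n" "Q \<in> carrier_mat n n" "P * Q = 1\<^sub>m n" "Q * P = 1\<^sub>m n"
    and T: "T = (\<lambda>A. P * A * Q) ` S"
    using assms by (auto simp: similar_sets_def)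
  have "(\<lambda>A. Q * A * P) ` T = (\<lambda>A. A) ` S"
    unfolding T image_image using assms(1) PQ by (intro image_cong) (auto intro!: mat_conj_cancel)
  then show ?thesis unfolding similar_sets_def using PQ by auto
qed

lemma similar_sets_trans:
  assumes "S \<subseteq> carrier_mat n n" "similar_sets n S T" "similar_sets n T U"
  shows "similar_sets n S U"
proof -
  obtain P Q where PQ: "P \<in> carrier_mat n n" "Q \<in> carrier_mat n n" "P * Q = 1\<^sub>m n" "Q * P = 1\<^sub>m n"
    and T: "T = (\<lambda>A. P * A * Q) ` S"
    using assms by (auto simp: similar_sets_def)
  obtain P' Q' where PQ': "P' \<in> carrier_mat n n" "Q' \<in> carrier_mat n n" "P' * Q' = 1\<^sub>m n" "Q' * P' = 1\<^sub>m n"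
    and U: "U = (\<lambda>A. P' * A * Q') ` T"
    using assms by (auto simp: similar_sets_def)
  have 1: "U = (\<lambda>A. (P' * P) * A * (Q * Q')) ` S"
    unfolding T U image_image using assms(1) PQ(1,2) PQ'(1,2)
    by (intro image_cong) (auto simp: assoc_mult_mat[of _ n n _ n _ n] mult_carrier_mat[of _ n n] subset_iff)
  have "(P' * P) * (Q * Q') = P' * (P * Q) * Q'" "(Q * Q') * (P' * P) = Q * (Q' * P') * P"
    using PQ(1,2) PQ'(1,2) by (auto simp: assoc_mult_mat[of _ n n _ n _ n] mult_carrier_mat[of _ n n])
  then have "(P' * P) * (Q * Q') = 1\<^sub>m n" "(Q * Q') * (P' * P) = 1\<^sub>m n"
    using PQ PQ' by auto
  then show ?thesis
    unfolding similar_sets_def using 1 PQ(1,2) PQ'(1,2)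
    by (intro exI[of _ "P' * P"] exI[of _ "Q * Q'"] conjI) (assumption | rule mult_carrier_mat)+
qed

lemma similar_sets_carrier:
  "S \<subseteq> carrier_mat n n \<Longrightarrow> similar_sets n S T \<Longrightarrow> T \<subseteq> carrier_mat n n"
  by (auto simp: similar_sets_def)

lemma mat_subspace_image:
  assumes S: "mat_subspace n (S :: 'a::field mat set)"
    and f: "\<And>A. A \<in> S \<Longrightarrow> f A \<in> carrier_mat m m"
    and add: "\<And>A B. A \<in> S \<Longrightarrow> B \<in> S \<Longrightarrow> f (A + B) = f A + f B"
    and smult: "\<And>c A. A \<in> S \<Longrightarrow> f (c \<cdot>\<^sub>m A) = c \<cdot>\<^sub>m f A"
  shows "mat_subspace m (f ` S)"
  unfolding mat_subspace_iff
proof (intro conjI ballI allI)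
  show "f ` S \<subseteq> carrier_mat m m" using f by auto
  have 0: "0\<^sub>m n n \<in> S" using S by (simp add: mat_subspace_iff)
  have "f (0 \<cdot>\<^sub>m 0\<^sub>m n n) = 0 \<cdot>\<^sub>m f (0\<^sub>m n n)" by (rule smult[OF 0])
  also have "0 \<cdot>\<^sub>m f (0\<^sub>m n n) = 0\<^sub>m m m" using f[OF 0] by (intro eq_matI) auto
  also have "0 \<cdot>\<^sub>m 0\<^sub>m n n = (0\<^sub>m n n :: 'a mat)" by (intro eq_matI) auto
  finally show "0\<^sub>m m m \<in> f ` S" by (metis 0 imageI)
  show "X + Y \<in> f ` S" if XY: "X \<in> f ` S" "Y \<in> f ` S" for X Y
  proof -
    obtain A B where "A \<in> S" "B \<in> S" "X = f A" "Y = f B" using XY by blast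
    then show ?thesis
      using S add[of A B] by (metis imageI mat_subspace_iff)
  qed
  show "c \<cdot>\<^sub>m X \<in> f ` S" if X: "X \<in> f ` S" for c X
  proof -
    obtain A where "A \<in> S" "X = f A" using X by blast
    then show ?thesis
      using S smult[of A c] by (metis imageI mat_subspace_iff)
  qed
qed

lemma mat_subspace_subsetD: "mat_subspace n S \<Longrightarrow> S \<subseteq> carrier_mat n n"
  by (simp add: mat_subspace_iff)

lemma mat_conj_add:
  fixes P Q A B :: "'a::field mat"
  assumes "P \<in> carrier_mat n n" "Q \<in> carrier_mat n n" "A \<in> carrier_mat n n" "B \<in> carrier_mat n n"
  shows "P * (A + B) * Q = P * A * Q + P * B * Q"
  using assms
  by (simp add: mult_add_distrib_mat[of _ n n] add_mult_distrib_mat[of _ n n] mult_carrier_mat[of _ n n])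

lemma mat_conj_smult:
  fixes P Q A :: "'a::field mat"
  assumes "P \<in> carrier_mat n n" "Q \<in> carrier_mat n n" "A \<in> carrier_mat n n"
  shows "P * (c \<cdot>\<^sub>m A) * Q = c \<cdot>\<^sub>m (P * A * Q)"
proof -
  have "P * (c \<cdot>\<^sub>m A) * Q = c \<cdot>\<^sub>m (P * A) * Q"
    using assms by (simp add: mult_smult_distrib[of _ n n])
  also have "\<dots> = c \<cdot>\<^sub>m (P * A * Q)"
    using assms by (intro mult_smult_assoc_mat[of _ n n]) auto
  finally show ?thesis .
qed

lemma similar_sets_weakly_triangularizable:
  assumes S: "weakly_triangularizable n S" and sim: "similar_sets n S T"
  shows "weakly_triangularizable n T" "mat_subspace_dim n T = mat_subspace_dim n S"
proof -
  obtain P Q where PQ: "P \<in> carrier_mat n n" "Q \<in> carrier_mat n n" "P * Q = 1\<^sub>m n" "Q * P = 1\<^sub>m n"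
    and T: "T = (\<lambda>A. P * A * Q) ` S"
    using sim by (auto simp: similar_sets_def)
  have sub: "mat_subspace n S" and Sn: "S \<subseteq> carrier_mat n n"
    using S mat_subspace_subsetD by (auto simp: weakly_triangularizable_def)
  have carr: "A \<in> carrier_mat n n" if "A \<in> S" for A using that Sn by blast
  have T': "mat_subspace n T"
    unfolding T by (rule mat_subspace_image[OF sub])
      (use PQ carr in \<open>simp_all add: mat_conj_add[of _ n] mat_conj_smult[of _ n] mult_carrier_mat[of _ n n]\<close>)
  moreover have "triangularizable (P * A * Q)" if A: "A \<in> S" for A
  proof (rule triangularizable_similar)
    show "triangularizable A" using A S by (simp add: weakly_triangularizable_def)
    show "similar_mat (P * A * Q) A"
      by (rule similar_matI[of _ _ P Q n]) (use A Sn PQ in \<open>auto simp: mult_carrier_mat[of _ n n]\<close>)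
  qed
  ultimately show "weakly_triangularizable n T"
    by (auto simp: weakly_triangularizable_def T)
  have "inj_on (\<lambda>A. P * A * Q) S"
  proof (rule inj_on_inverseI)
    show "Q * (P * A * Q) * P = A" if "A \<in> S" for A
      using that PQ Sn by (intro mat_conj_cancel) auto
  qed
  then have "bij_betw (\<lambda>A. P * A * Q) S T"
    by (simp add: T bij_betw_def)
  then show "mat_subspace_dim n T = mat_subspace_dim n S"
    by (rule mat_subspace_dim_bij[OF sub T', symmetric])
      (use PQ carr in \<open>simp_all add: mat_conj_add[of _ n] mat_conj_smult[of _ n]\<close>)
qed

section \<open>The maximal dimension is attained\<close>

lemma zero_weakly_triangularizable: "weakly_triangularizable n {0\<^sub>m n n :: 'a::field mat}"
proof -
  have "upper_triangular (0\<^sub>m n n :: 'a mat)" by (auto simp: upper_triangular_def)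
  then have "triangularizable (0\<^sub>m n n :: 'a mat)"
    using similar_mat_refl[of "0\<^sub>m n n" n] by (auto simp: triangularizable_def)
  then show ?thesis by (auto simp: weakly_triangularizable_def mat_subspace_iff)
qed

lemma finite_weakly_triangularizable_dims:
  "finite {mat_subspace_dim n S | S :: 'a::field mat set. weakly_triangularizable n S}"
proof (rule finite_subset)
  have "mat_subspace n (carrier_mat n n :: 'a mat set)" by (auto simp: mat_subspace_iff)
  then show "{mat_subspace_dim n S | S :: 'a mat set. weakly_triangularizable n S}
      \<subseteq> {..mat_subspace_dim n (carrier_mat n n :: 'a mat set)}"
    using mat_subspace_dim_mono mat_subspace_subsetD unfolding weakly_triangularizable_def by blast
qed simp

lemma weakly_triangularizable_dim_le_max:
  fixes S :: "'a::field mat set"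
  assumes "weakly_triangularizable n S"
  shows "mat_subspace_dim n S \<le> max_wt_dim TYPE('a) n"
  unfolding max_wt_dim_def using assms finite_weakly_triangularizable_dims by (intro Max_ge) auto

lemma optimal_wt_exists: "\<exists>S :: 'a::field mat set. optimal_wt n S"
proof -
  let ?D = "{mat_subspace_dim n S | S :: 'a mat set. weakly_triangularizable n S}"
  have "Max ?D \<in> ?D"
    using finite_weakly_triangularizable_dims zero_weakly_triangularizable by (intro Max_in) blast+
  then show ?thesis by (auto simp: optimal_wt_def max_wt_dim_def)
qed

section \<open>Joints\<close>

text \<open>
Membership in a joint is a condition on two diagonal blocks and on the entries below them. This turns
nested joints, conjugation and dimension counts into statements about \<open>diag_block\<close> and
\<open>block_upper\<close>, without splitting matrices into four parts.
\<close>
lemma joint_eq: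
  assumes A: "A \<subseteq> carrier_mat a a" and B: "B \<subseteq> carrier_mat b b"
  shows "joint A B = {M. block_upper a (a + b) M \<and> diag_block 0 a M \<in> A \<and> diag_block a b M \<in> B}"
proof (intro Set.set_eqI iffI)
  fix M assume "M \<in> joint A B"
  then obtain X Y C where "M = four_block_mat X C (0\<^sub>m (dim_row Y) (dim_col X)) Y"
    "X \<in> A" "Y \<in> B" "C \<in> carrier_mat (dim_row X) (dim_col Y)"
    unfolding joint_def by blast
  moreover have "X \<in> carrier_mat a a" "Y \<in> carrier_mat b b" using calculation(2,3) A B by blast+
  ultimately show "M \<in> {M. block_upper a (a + b) M \<and> diag_block 0 a M \<in> A \<and> diag_block a b M \<in> B}"
    using block_upper_four_block[of X a Y b C] by simp
next
  fix M assume M: "M \<in> {M. block_upper a (a + b) M \<and> diag_block 0 a M \<in> A \<and> diag_block a b M \<in> B}"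
  let ?C = "mat a b (\<lambda>(r, c). M $$ (r, a + c))"
  have 1: "M = four_block_mat (diag_block 0 a M) ?C
      (0\<^sub>m (dim_row (diag_block a b M)) (dim_col (diag_block 0 a M))) (diag_block a b M)"
    using block_upper_eq_four_block[of a b M] M by simp
  have 2: "diag_block 0 a M \<in> A" "diag_block a b M \<in> B"
    "?C \<in> carrier_mat (dim_row (diag_block 0 a M)) (dim_col (diag_block a b M))"
    using M by simp_all
  show "M \<in> joint A B"
    unfolding joint_def by (rule CollectI, intro exI conjI) (rule 1, (rule 2)+)
qed

lemma block_upper_carrier: "block_upper a n M \<Longrightarrow> M \<in> carrier_mat n n"
  by (simp add: block_upper_def)

lemma joint_carrier:
  "A \<subseteq> carrier_mat a a \<Longrightarrow> B \<subseteq> carrier_mat b b \<Longrightarrow> joint A B \<subseteq> carrier_mat (a + b) (a + b)"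
  by (auto simp: joint_eq[of A a B b] block_upper_def)

lemma diag_block_image_joint:
  assumes A: "A \<subseteq> carrier_mat a a" and B: "B \<subseteq> carrier_mat b b"
  shows "B \<noteq> {} \<Longrightarrow> diag_block 0 a ` joint A B = A" "A \<noteq> {} \<Longrightarrow> diag_block a b ` joint A B = B"
proof -
  have *: "\<exists>M\<in>joint A B. diag_block 0 a M = X \<and> diag_block a b M = Y" if "X \<in> A" "Y \<in> B" for X Y
  proof -
    have "X \<in> carrier_mat a a" "Y \<in> carrier_mat b b" using that A B by blast+
    then show ?thesis
      using block_upper_four_block[of X a Y b "0\<^sub>m a b"] that
      by (intro bexI[of _ "four_block_mat X (0\<^sub>m a b) (0\<^sub>m b a) Y"]) (simp_all add: joint_eq[OF A B])
  qed
  have sub: "diag_block 0 a ` joint A B \<subseteq> A" "diag_block a b ` joint A B \<subseteq> B"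
    by (auto simp: joint_eq[OF A B])
  show "diag_block 0 a ` joint A B = A" if "B \<noteq> {}"
  proof (rule subset_antisym[OF sub(1)], rule subsetI)
    fix X assume "X \<in> A"
    with that obtain Y where "Y \<in> B" by blast
    from *[OF \<open>X \<in> A\<close> this] show "X \<in> diag_block 0 a ` joint A B" by blast
  qed
  show "diag_block a b ` joint A B = B" if "A \<noteq> {}"
  proof (rule subset_antisym[OF sub(2)], rule subsetI)
    fix Y assume "Y \<in> B"
    with that obtain X where "X \<in> A" by blast
    from *[OF this \<open>Y \<in> B\<close>] show "Y \<in> diag_block a b ` joint A B" by blast
  qed
qed

lemma mat_subspace_joint:
  fixes A B :: "'a::field mat set"
  assumes A: "mat_subspace a A" and B: "mat_subspace b B"
  shows "mat_subspace (a + b) (joint A B)"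
proof -
  note eq = joint_eq[OF mat_subspace_subsetD[OF A] mat_subspace_subsetD[OF B]]
  show ?thesis
    unfolding mat_subspace_iff eq
  proof (intro conjI subsetI allI ballI CollectI; (elim CollectE conjE)?)
    show "block_upper a (a + b) (X + Y)" if "block_upper a (a + b) X" "block_upper a (a + b) Y"
      for X Y :: "'a mat"
      using that by (auto simp: block_upper_def)
    show "block_upper a (a + b) (c \<cdot>\<^sub>m X)" if "block_upper a (a + b) X" for c and X :: "'a mat"
      using that by (auto simp: block_upper_def)
    fix X Y :: "'a mat" and c
    assume X: "block_upper a (a + b) X" "diag_block 0 a X \<in> A" "diag_block a b X \<in> B"
    then have Xc: "X \<in> carrier_mat (a + b) (a + b)" by (simp add: block_upper_def)
    show "diag_block 0 a (c \<cdot>\<^sub>m X) \<in> A" "diag_block a b (c \<cdot>\<^sub>m X) \<in> B"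
      using A B X Xc by (simp_all add: mat_subspace_iff diag_block_smult[of _ "a + b"])
    assume Y: "block_upper a (a + b) Y" "diag_block 0 a Y \<in> A" "diag_block a b Y \<in> B"
    then have Yc: "Y \<in> carrier_mat (a + b) (a + b)" by (simp add: block_upper_def)
    show "diag_block 0 a (X + Y) \<in> A" "diag_block a b (X + Y) \<in> B"
      using A B X Y Xc Yc by (simp_all add: mat_subspace_iff diag_block_add[of _ "a + b"])
  qed (use A B in \<open>auto simp: mat_subspace_iff block_upper_def\<close>)
qed

lemma weakly_triangularizable_joint:
  assumes "weakly_triangularizable a A" "weakly_triangularizable b B"
  shows "weakly_triangularizable (a + b) (joint A B)"
proof -
  have A: "mat_subspace a A" and B: "mat_subspace b B"
    using assms by (simp_all add: weakly_triangularizable_def)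
  have "triangularizable M" if "M \<in> joint A B" for M
    using that assms triangularizable_block_upper
    unfolding joint_eq[OF mat_subspace_subsetD[OF A] mat_subspace_subsetD[OF B]] weakly_triangularizable_def
    by blast
  then show ?thesis
    using mat_subspace_joint[OF A B] by (simp add: weakly_triangularizable_def)
qed

lemma mat_subspace_kernel:
  assumes S: "mat_subspace n (S :: 'a::field mat set)"
    and add: "\<And>A B. A \<in> S \<Longrightarrow> B \<in> S \<Longrightarrow> f (A + B) = f A + f B"
    and smult: "\<And>c A. A \<in> S \<Longrightarrow> f (c \<cdot>\<^sub>m A) = c \<cdot>\<^sub>m f A"
    and 0: "f (0\<^sub>m n n) = 0\<^sub>m m m"
  shows "mat_subspace n {A \<in> S. f A = (0\<^sub>m m m :: 'a mat)}"
  using assms by (auto simp: mat_subspace_iff)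

text \<open>
Rank and nullity, applied first to the upper left block and then, on its kernel \<open>K\<close>, to the lower right
block. What remains is the space \<open>L\<close> of matrices supported on the upper right \<open>a \<times> b\<close> rectangle,
whose entries, read row by row, form an arbitrary vector of length \<open>a * b\<close>.
\<close>
lemma mat_subspace_dim_joint:
  fixes A B :: "'a::field mat set"
  assumes A: "mat_subspace a A" and B: "mat_subspace b B"
  shows "mat_subspace_dim (a + b) (joint A B) = mat_subspace_dim a A + mat_subspace_dim b B + a * b"
proof -
  let ?n = "a + b"
  note Ac = mat_subspace_subsetD[OF A] and Bc = mat_subspace_subsetD[OF B]
  note eq = joint_eq[OF Ac Bc]
  have 0: "0\<^sub>m a a \<in> A" "0\<^sub>m b b \<in> B" using A B by (auto simp: mat_subspace_iff)
  note lin = diag_block_add[of _ ?n] diag_block_smult[of _ ?n]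
  define K where "K = {M \<in> joint A B. diag_block 0 a M = 0\<^sub>m a a}"
  define L where "L = {M \<in> K. diag_block a b M = 0\<^sub>m b b}"
  have J: "mat_subspace ?n (joint A B)" by (rule mat_subspace_joint[OF A B])
  then have Jc: "joint A B \<subseteq> carrier_mat ?n ?n" by (rule mat_subspace_subsetD)
  have K: "mat_subspace ?n K"
    unfolding K_def using Jc by (intro mat_subspace_kernel[OF J]) (auto simp: lin subset_iff)
  have Kc: "K \<subseteq> carrier_mat ?n ?n" using mat_subspace_subsetD[OF K] .
  have L: "mat_subspace ?n L"
    unfolding L_def using Kc by (intro mat_subspace_kernel[OF K]) (auto simp: lin subset_iff)
  have "mat_subspace_dim ?n (joint A B) =
      mat_subspace_dim a (diag_block 0 a ` joint A B) + mat_subspace_dim ?n K"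
    unfolding K_def using Jc by (intro mat_rank_nullity[OF J]) (auto simp: lin subset_iff)
  also have "diag_block 0 a ` joint A B = A"
    using diag_block_image_joint(1)[OF Ac Bc] 0 by blast
  also have "mat_subspace_dim ?n K =
      mat_subspace_dim b (diag_block a b ` K) + mat_subspace_dim ?n L"
    unfolding L_def using Kc by (intro mat_rank_nullity[OF K]) (auto simp: lin subset_iff)
  also have "diag_block a b ` K = B"
  proof -
    have "K = joint {0\<^sub>m a a} B" using 0 by (auto simp: K_def eq joint_eq[of _ a _ b] Bc)
    then show ?thesis using diag_block_image_joint(2)[of "{0\<^sub>m a a}" a B b] Bc by auto
  qed
  also have "mat_subspace_dim ?n L = a * b"
  proof (rule mat_subspace_dim_vec[OF L])
    let ?f = "\<lambda>v :: 'a vec. mat ?n ?n (\<lambda>(r, c). if r < a \<and> a \<le> c then v $ (r * b + (c - a)) else 0)"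
    have bd: "r * b + c < a * b" if "r < a" "c < b" for r c
    proof -
      have "r * b + c < Suc r * b" using that by simp
      also have "\<dots> \<le> a * b" using that by (intro mult_right_mono) auto
      finally show ?thesis .
    qed
    show "bij_betw ?f (carrier_vec (a * b)) L"
    proof (rule bij_betwI[where g = "\<lambda>M. vec (a * b) (\<lambda>k. M $$ (k div b, a + k mod b))"])
      have "?f v \<in> L" for v
      proof -
        have "diag_block 0 a (?f v) = 0\<^sub>m a a" "diag_block a b (?f v) = 0\<^sub>m b b"
          by (auto intro!: eq_matI)
        moreover have "block_upper a ?n (?f v)" by (auto simp: block_upper_def)
        ultimately show ?thesis using 0 by (simp add: L_def K_def eq)
      qed
      then show "?f \<in> carrier_vec (a * b) \<rightarrow> L" by blast
    next
      fix v :: "'a vec" assume v: "v \<in> carrier_vec (a * b)"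
      show "vec (a * b) (\<lambda>k. ?f v $$ (k div b, a + k mod b)) = v"
      proof (rule eq_vecI)
        fix k assume "k < dim_vec v"
        then have k: "k < a * b" using v by simp
        then have "k div b < a" "k mod b < b"
          by (auto simp: less_mult_imp_div_less intro!: mod_less_divisor gr0I)
        then show "vec (a * b) (\<lambda>k. ?f v $$ (k div b, a + k mod b)) $ k = v $ k"
          using k by simp
      qed (use v in auto)
    next
      fix M assume M: "M \<in> L"
      then have b: "block_upper a ?n M" and z: "diag_block 0 a M = 0\<^sub>m a a" "diag_block a b M = 0\<^sub>m b b"
        by (auto simp: L_def K_def eq)
      have z1: "M $$ (r, c) = 0" if "r < a" "c < a" for r c
        using arg_cong[OF z(1), of "\<lambda>X. X $$ (r, c)"] that by simp
      have z2: "M $$ (r, c) = 0" if "a \<le> r" "r < ?n" "a \<le> c" "c < ?n" for r c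
        using arg_cong[OF z(2), of "\<lambda>X. X $$ (r - a, c - a)"] that by simp
      show "?f (vec (a * b) (\<lambda>k. M $$ (k div b, a + k mod b))) = M"
      proof (rule eq_matI)
        fix r c assume rc: "r < dim_row M" "c < dim_col M"
        then have rc: "r < ?n" "c < ?n" using block_upper_carrier[OF b] by auto
        show "?f (vec (a * b) (\<lambda>k. M $$ (k div b, a + k mod b))) $$ (r, c) = M $$ (r, c)"
        proof (cases "r < a \<and> a \<le> c")
          case True
          then have "c - a < b" using rc by auto
          moreover have "(r * b + (c - a)) div b = r" "(r * b + (c - a)) mod b = c - a"
            using \<open>c - a < b\<close> by auto
          ultimately show ?thesis using True rc bd[of r "c - a"] by (simp del: add_diff_assoc)
        next
          case False
          then show ?thesis using rc z1[of r c] z2[of r c] b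
            by (cases "r < a"; cases "c < a") (auto simp: block_upper_def not_le not_less)
        qed
      qed (use block_upper_carrier[OF b] in auto)
    qed (auto)
    show "?f (v + w) = ?f v + ?f w" if "v \<in> carrier_vec (a * b)" "w \<in> carrier_vec (a * b)" for v w
    proof (rule eq_matI)
      fix r c assume "r < dim_row (?f v + ?f w)" "c < dim_col (?f v + ?f w)"
      then have rc: "r < ?n" "c < ?n" by auto
      then show "?f (v + w) $$ (r, c) = (?f v + ?f w) $$ (r, c)"
        using that bd[of r "c - a"] by auto
    qed auto
    show "?f (c \<cdot>\<^sub>v v) = c \<cdot>\<^sub>m ?f v" if "v \<in> carrier_vec (a * b)" for c v
    proof (rule eq_matI)
      fix r k assume "r < dim_row (c \<cdot>\<^sub>m ?f v)" "k < dim_col (c \<cdot>\<^sub>m ?f v)"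
      then have rc: "r < ?n" "k < ?n" by auto
      then show "?f (c \<cdot>\<^sub>v v) $$ (r, k) = (c \<cdot>\<^sub>m ?f v) $$ (r, k)"
        using that bd[of r "k - a"] by auto
    qed auto
  qed
  finally show ?thesis by simp
qed

lemma zero_space_carrier [simp]: "{0\<^sub>m 0 0} \<subseteq> carrier_mat 0 0" by simp

lemma joint_zero_left:
  assumes X: "X \<subseteq> carrier_mat b b"
  shows "joint {0\<^sub>m 0 0} X = X"
proof -
  have "block_upper 0 b M \<longleftrightarrow> M \<in> carrier_mat b b" for M :: "'a mat" by (simp add: block_upper_def)
  moreover have "diag_block 0 0 M = 0\<^sub>m 0 0" for M :: "'a mat" by (intro eq_matI) auto
  ultimately show ?thesis
    using X joint_eq[of "{0\<^sub>m 0 0}" 0 X b] by (auto simp: diag_block_whole)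
qed

lemma joint_zero_right:
  assumes X: "X \<subseteq> carrier_mat a a"
  shows "joint X {0\<^sub>m 0 0} = X"
proof -
  have "block_upper a a M \<longleftrightarrow> M \<in> carrier_mat a a" for M :: "'a mat" by (auto simp: block_upper_def)
  moreover have "diag_block a 0 M = 0\<^sub>m 0 0" for M :: "'a mat" by (intro eq_matI) auto
  ultimately show ?thesis
    using X joint_eq[of X a "{0\<^sub>m 0 0}" 0] by (auto simp: diag_block_whole)
qed

lemma block_upper_nested:
  "block_upper a (a + (b + c)) M \<and> block_upper b (b + c) (diag_block a (b + c) M) \<longleftrightarrow>
   block_upper (a + b) (a + b + c) M \<and> block_upper a (a + b) (diag_block 0 (a + b) M)"
  (is "?L \<longleftrightarrow> ?R")
proof
  assume L: ?L
  then have 1: "M $$ (i, j) = 0" if "a \<le> i" "i < a + b + c" "j < a" for i j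
    using that by (simp add: block_upper_def)
  have 2: "M $$ (i, j) = 0" if "a + b \<le> i" "i < a + b + c" "a \<le> j" "j < a + b" for i j
  proof -
    have "diag_block a (b + c) M $$ (i - a, j - a) = 0"
    proof -
      have "b \<le> i - a \<and> i - a < b + c \<and> j - a < b" using that by linarith
      then show ?thesis using L unfolding block_upper_def by blast
    qed
    then show ?thesis using that by simp
  qed
  have "M $$ (i, j) = 0" if "a + b \<le> i" "i < a + b + c" "j < a + b" for i j
    using 1[of i j] 2[of i j] that by (cases "j < a") auto
  then show ?R using L 1 by (auto simp: block_upper_def add.assoc)
next
  assume R: ?R
  then have 1: "M $$ (i, j) = 0" if "a + b \<le> i" "i < a + b + c" "j < a + b" for i j
    using that by (simp add: block_upper_def)
  have 2: "M $$ (i, j) = 0" if "a \<le> i" "i < a + b" "j < a" for i j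
  proof -
    have "diag_block 0 (a + b) M $$ (i, j) = 0"
      using R that unfolding block_upper_def by (auto simp del: diag_block_index)
    then show ?thesis using that by simp
  qed
  have "M $$ (i, j) = 0" if "a \<le> i" "i < a + b + c" "j < a" for i j
    using 1[of i j] 2[of i j] that by (cases "i < a + b") auto
  then show ?L using R 1 by (auto simp: block_upper_def add.assoc)
qed

lemma joint_assoc:
  assumes A: "A \<subseteq> carrier_mat a a" and B: "B \<subseteq> carrier_mat b b" and C: "C \<subseteq> carrier_mat c c"
  shows "joint A (joint B C) = joint (joint A B) C"
proof -
  note eqs = joint_eq[OF A joint_carrier[OF B C]] joint_eq[OF joint_carrier[OF A B] C]
  show ?thesis
    unfolding eqs unfolding joint_eq[OF A B] joint_eq[OF B C]
  proof (rule Collect_cong)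
    fix M
    show "(block_upper a (a + (b + c)) M \<and> diag_block 0 a M \<in> A \<and>
        diag_block a (b + c) M \<in> {M. block_upper b (b + c) M \<and> diag_block 0 b M \<in> B \<and> diag_block b c M \<in> C})
      \<longleftrightarrow> (block_upper (a + b) (a + b + c) M \<and>
        diag_block 0 (a + b) M \<in> {M. block_upper a (a + b) M \<and> diag_block 0 a M \<in> A \<and> diag_block a b M \<in> B}
        \<and> diag_block (a + b) c M \<in> C)"
      using block_upper_nested[of a b c M] by (auto simp: diag_block_diag_block)
  qed
qed

lemma joints_carrier:
  "list_all2 (\<lambda>k S. S \<subseteq> carrier_mat k k) ns Ss \<Longrightarrow> joints Ss \<subseteq> carrier_mat (sum_list ns) (sum_list ns)"
proof (induction Ss arbitrary: ns rule: joints.induct)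
  case (3 A B Cs)
  then obtain a ms where "ns = a # ms" "A \<subseteq> carrier_mat a a"
    "list_all2 (\<lambda>k S. S \<subseteq> carrier_mat k k) ms (B # Cs)"
    by (auto simp: list_all2_Cons2)
  with 3 show ?case using joint_carrier[of A a "joints (B # Cs)" "sum_list ms"] by simp
qed (auto simp: list_all2_Cons2)

text \<open>
The empty joint, the space of \<open>0 \<times> 0\<close> matrices, is neutral for joints, so the singleton list needs no
case of its own.
\<close>
lemma joints_Cons:
  "A \<subseteq> carrier_mat a a \<Longrightarrow> joints (A # R) = joint A (joints R)"
  by (cases R) (auto simp: joint_zero_right)

lemma joints_append:
  assumes "list_all2 (\<lambda>k S. S \<subseteq> carrier_mat k k) ns Ss" "list_all2 (\<lambda>k S. S \<subseteq> carrier_mat k k) ms Ts"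
  shows "joints (Ss @ Ts) = joint (joints Ss) (joints Ts)"
  using assms(1)
proof (induction rule: list_all2_induct)
  case Nil
  then show ?case using joint_zero_left[OF joints_carrier[OF assms(2)]] by simp
next
  case (Cons a ns A Ss)
  then show ?case
    using joint_assoc[OF Cons(1) joints_carrier[OF Cons(2)] joints_carrier[OF assms(2)]]
    by (simp add: joints_Cons[of _ a])
qed

lemma joint_conj_subset:
  assumes A: "A \<subseteq> carrier_mat a a" and B: "B \<subseteq> carrier_mat b b"
    and P: "block_upper a (a + b) P" and Q: "block_upper a (a + b) Q" and M: "M \<in> joint A B"
  shows "P * M * Q \<in> joint ((\<lambda>X. diag_block 0 a P * X * diag_block 0 a Q) ` A)
                           ((\<lambda>X. diag_block a b P * X * diag_block a b Q) ` B)"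
proof -
  have M': "block_upper a (a + b) M" "diag_block 0 a M \<in> A" "diag_block a b M \<in> B"
    using M by (auto simp: joint_eq[OF A B])
  note PM = block_upper_mult[OF P M'(1)]
  note PMQ = block_upper_mult[OF PM(1) Q]
  have c: "(\<lambda>X. diag_block 0 a P * X * diag_block 0 a Q) ` A \<subseteq> carrier_mat a a"
    "(\<lambda>X. diag_block a b P * X * diag_block a b Q) ` B \<subseteq> carrier_mat b b"
    by (auto intro!: carrier_matI)
  show ?thesis
    unfolding joint_eq[OF c] using PM PMQ M' by auto
qed

text \<open>
Conjugation by the block diagonal matrix built from \<open>P1\<close> and \<open>P2\<close>. It maps the first joint into the
second, and conjugation by its inverse maps the second into the first, so the image is everything.
\<close>
lemma similar_sets_joint:
  assumes A: "A \<subseteq> carrier_mat a a" and B: "B \<subseteq> carrier_mat b b"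
    and AA: "similar_sets a A A'" and BB: "similar_sets b B B'"
  shows "similar_sets (a + b) (joint A B) (joint A' B')"
proof -
  let ?n = "a + b"
  obtain P1 Q1 where 1: "P1 \<in> carrier_mat a a" "Q1 \<in> carrier_mat a a" "P1 * Q1 = 1\<^sub>m a" "Q1 * P1 = 1\<^sub>m a"
    and A': "A' = (\<lambda>A. P1 * A * Q1) ` A" using AA by (auto simp: similar_sets_def)
  obtain P2 Q2 where 2: "P2 \<in> carrier_mat b b" "Q2 \<in> carrier_mat b b" "P2 * Q2 = 1\<^sub>m b" "Q2 * P2 = 1\<^sub>m b"
    and B': "B' = (\<lambda>A. P2 * A * Q2) ` B" using BB by (auto simp: similar_sets_def)
  define P where "P = four_block_mat P1 (0\<^sub>m a b) (0\<^sub>m b a) P2"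
  define Q where "Q = four_block_mat Q1 (0\<^sub>m a b) (0\<^sub>m b a) Q2"
  have PQc: "P \<in> carrier_mat ?n ?n" "Q \<in> carrier_mat ?n ?n" using 1 2 by (auto simp: P_def Q_def)
  have PQ: "P * Q = 1\<^sub>m ?n" "Q * P = 1\<^sub>m ?n"
    using 1 2 unfolding P_def Q_def
    by (simp_all add: mult_four_block_mat[of _ a a _ b _ b _ _ a _ b])
  have P: "block_upper a ?n P" "diag_block 0 a P = P1" "diag_block a b P = P2"
    unfolding P_def using 1 2 by (simp_all add: block_upper_four_block)
  have Q: "block_upper a ?n Q" "diag_block 0 a Q = Q1" "diag_block a b Q = Q2"
    unfolding Q_def using 1 2 by (simp_all add: block_upper_four_block)
  have A'c: "A' \<subseteq> carrier_mat a a" and B'c: "B' \<subseteq> carrier_mat b b"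
    using similar_sets_carrier A AA B BB by blast+
  have unconj: "A = (\<lambda>X. Q1 * X * P1) ` A'" "B = (\<lambda>X. Q2 * X * P2) ` B'"
  proof -
    have "(\<lambda>X. Q1 * (P1 * X * Q1) * P1) ` A = (\<lambda>X. X) ` A"
      using A 1 by (intro image_cong) (auto intro!: mat_conj_cancel[of _ a])
    then show "A = (\<lambda>X. Q1 * X * P1) ` A'" unfolding A' image_image by simp
    have "(\<lambda>X. Q2 * (P2 * X * Q2) * P2) ` B = (\<lambda>X. X) ` B"
      using B 2 by (intro image_cong) (auto intro!: mat_conj_cancel[of _ b])
    then show "B = (\<lambda>X. Q2 * X * P2) ` B'" unfolding B' image_image by simp
  qed
  have "joint A' B' = (\<lambda>M. P * M * Q) ` joint A B"
  proof (intro subset_antisym subsetI)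
    fix M assume "M \<in> (\<lambda>M. P * M * Q) ` joint A B"
    then show "M \<in> joint A' B'"
      using joint_conj_subset[OF A B P(1) Q(1)] unfolding P Q A'[symmetric] B'[symmetric] by auto
  next
    fix M assume M: "M \<in> joint A' B'"
    then have "Q * M * P \<in> joint A B"
      using joint_conj_subset[OF A'c B'c Q(1) P(1) M] unfolding P Q unconj[symmetric] by simp
    moreover have "P * (Q * M * P) * Q = M"
      using PQc PQ joint_carrier[OF A'c B'c] M by (intro mat_conj_cancel) auto
    ultimately show "M \<in> (\<lambda>M. P * M * Q) ` joint A B" by (intro image_eqI[of _ _ "Q * M * P"]) auto
  qed
  then show ?thesis unfolding similar_sets_def using PQc PQ by blast
qed

section \<open>Decomposition of an optimal space\<close>

text \<open>
If a factor is exchanged for an optimal space of the same size, the joint stays weakly triangularizable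
and its dimension changes by as much as that of the factor. As the joint cannot grow, neither could
the factor.
\<close>
lemma optimal_wt_joint_factors:
  fixes A B :: "'a::field mat set"
  assumes A: "weakly_triangularizable a A" and B: "weakly_triangularizable b B"
    and opt: "optimal_wt (a + b) (joint A B)"
  shows "optimal_wt a A" "optimal_wt b B"
proof -
  have dim: "mat_subspace_dim (a + b) (joint X Y) = mat_subspace_dim a X + mat_subspace_dim b Y + a * b"
    if "weakly_triangularizable a X" "weakly_triangularizable b Y" for X Y :: "'a mat set"
    using that by (simp add: weakly_triangularizable_def mat_subspace_dim_joint)
  have le: "mat_subspace_dim (a + b) (joint X Y) \<le> mat_subspace_dim (a + b) (joint A B)"
    if "weakly_triangularizable a X" "weakly_triangularizable b Y" for X Y :: "'a mat set"
    using weakly_triangularizable_dim_le_max[OF weakly_triangularizable_joint[OF that]] opt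
    by (simp add: optimal_wt_def)
  obtain A' :: "'a mat set" where A': "optimal_wt a A'"
    using optimal_wt_exists[of a] by (rule exE)
  obtain B' :: "'a mat set" where B': "optimal_wt b B'"
    using optimal_wt_exists[of b] by (rule exE)
  have "mat_subspace_dim a A' \<le> mat_subspace_dim a A"
    using le[of A' B] dim[of A' B] dim[OF A B] A' B by (simp add: optimal_wt_def)
  moreover have "mat_subspace_dim b B' \<le> mat_subspace_dim b B"
    using le[of A B'] dim[of A B'] dim[OF A B] A B' by (simp add: optimal_wt_def)
  ultimately show "optimal_wt a A" "optimal_wt b B"
    using A B A' B' weakly_triangularizable_dim_le_max[OF A] weakly_triangularizable_dim_le_max[OF B]
    by (auto simp: optimal_wt_def intro!: antisym)
qed

lemma optimal_wt_similar:
  "optimal_wt n S \<Longrightarrow> similar_sets n S T \<Longrightarrow> optimal_wt n T"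
  using similar_sets_weakly_triangularizable[of n S T] by (simp add: optimal_wt_def)

lemma optimal_wt_carrier: "optimal_wt n S \<Longrightarrow> S \<subseteq> carrier_mat n n"
  by (simp add: optimal_wt_def weakly_triangularizable_def mat_subspace_subsetD)

text \<open>
Here \<open>S'\<close> is \<open>S\<close> in a basis adapted to the invariant subspace \<open>W\<close>. It lies in the joint of its
spaces of diagonal blocks, and its dimension is already maximal.
\<close>
lemma reducible_optimal_wt_similar_joint:
  fixes S :: "'a::field mat set"
  assumes S: "optimal_wt n S" and red: "\<not> irreducible_mats n S"
  obtains a b A B where "n = a + b" "0 < a" "0 < b" "optimal_wt a A" "optimal_wt b B"
    "similar_sets n S (joint A B)"
proof -
  have Sc: "S \<subseteq> carrier_mat n n" by (rule optimal_wt_carrier[OF S])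
  obtain W where W: "VectorSpace.subspace class_ring W (module_vec TYPE('a) n)"
    and invar: "\<forall>A\<in>S. \<forall>w\<in>W. A *\<^sub>v w \<in> W" and proper: "W \<noteq> {0\<^sub>v n}" "W \<noteq> carrier_vec n"
    using red by (auto simp: irreducible_mats_def)
  obtain a P Q where a: "a \<le> n" and PQ: "P \<in> carrier_mat n n" "Q \<in> carrier_mat n n"
      "P * Q = 1\<^sub>m n" "Q * P = 1\<^sub>m n" and Weq: "W = {w \<in> carrier_vec n. P *\<^sub>v w \<in> coord_space n a}"
    using W by (rule subspace_straighten)
  have QP: "Q *\<^sub>v (P *\<^sub>v w) = w" if "w \<in> carrier_vec n" for w
    using that PQ by (metis assoc_mult_mat_vec one_mult_mat_vec)
  have "a \<noteq> 0"
  proof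
    assume "a = 0"
    have "w = 0\<^sub>v n" if "w \<in> W" for w
    proof -
      have "P *\<^sub>v w = 0\<^sub>v n"
        using that \<open>a = 0\<close> PQ by (intro eq_vecI) (auto simp: Weq coord_space_def)
      moreover have "Q *\<^sub>v 0\<^sub>v n = 0\<^sub>v n" using PQ by (intro eq_vecI) (auto simp: scalar_prod_def)
      ultimately show ?thesis using QP[of w] that Weq by simp
    qed
    moreover have "0\<^sub>v n \<in> W" using W by (simp add: vec_subspace_iff)
    ultimately show False using proper by blast
  qed
  moreover have "a \<noteq> n"
  proof
    assume "a = n"
    then have "W = carrier_vec n" using PQ by (auto simp: Weq coord_space_def)
    then show False using proper by simp
  qed
  ultimately have a: "0 < a" "a < n" using a by auto
  define b where "b = n - a"
  have n: "n = a + b" "0 < b" using a by (auto simp: b_def)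
  define S' where "S' = (\<lambda>M. P * M * Q) ` S"
  have sim: "similar_sets n S S'" using PQ by (auto simp: similar_sets_def S'_def)
  then have S': "optimal_wt n S'" by (rule optimal_wt_similar[OF S])
  then have wt: "mat_subspace n S'" "\<And>M. M \<in> S' \<Longrightarrow> triangularizable M"
    by (auto simp: optimal_wt_def weakly_triangularizable_def)
  have carr: "M \<in> carrier_mat n n" if "M \<in> S'" for M
    using that mat_subspace_subsetD[OF wt(1)] by blast
  have bu: "block_upper a (a + b) M" if M: "M \<in> S'" for M
  proof -
    obtain N where N: "N \<in> S" "M = P * N * Q" using M by (auto simp: S'_def)
    have "N \<in> carrier_mat n n" using N Sc by blast
    then have "block_upper a n (P * N * Q)"
    proof (rule block_upper_conj[OF PQ(1-3)])
      show "P *\<^sub>v (N *\<^sub>v w) \<in> coord_space n a"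
        if "w \<in> carrier_vec n" "P *\<^sub>v w \<in> coord_space n a" for w
      proof -
        have "N *\<^sub>v w \<in> W" using invar N that by (simp add: Weq)
        then show ?thesis by (simp add: Weq)
      qed
    qed (use a in simp)
    then show ?thesis using N n by simp
  qed
  define A where "A = diag_block 0 a ` S'"
  define B where "B = diag_block a b ` S'"
  have A: "weakly_triangularizable a A"
    unfolding weakly_triangularizable_def
  proof
    show "mat_subspace a A" unfolding A_def
      by (rule mat_subspace_image[OF wt(1)])
        (use n carr in \<open>simp_all add: diag_block_add[of _ n] diag_block_smult[of _ n]\<close>)
    show "\<forall>X\<in>A. triangularizable X"
      using wt(2) triangularizable_block_upper_iff[OF bu] by (auto simp: A_def)
  qed
  have B: "weakly_triangularizable b B"
    unfolding weakly_triangularizable_def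
  proof
    show "mat_subspace b B" unfolding B_def
      by (rule mat_subspace_image[OF wt(1)])
        (use n carr in \<open>simp_all add: diag_block_add[of _ n] diag_block_smult[of _ n]\<close>)
    show "\<forall>X\<in>B. triangularizable X"
      using wt(2) triangularizable_block_upper_iff[OF bu] by (auto simp: B_def)
  qed
  have AB: "mat_subspace a A" "mat_subspace b B" "A \<subseteq> carrier_mat a a" "B \<subseteq> carrier_mat b b"
    using A B mat_subspace_subsetD by (auto simp: weakly_triangularizable_def)
  have sub: "S' \<subseteq> joint A B" 
    unfolding joint_eq[OF AB(3,4)] using bu by (auto simp: A_def B_def)
  have J: "weakly_triangularizable n (joint A B)"
    using weakly_triangularizable_joint[OF A B] n by simp
  then have "mat_subspace n (joint A B)" by (simp add: weakly_triangularizable_def)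
  moreover have "mat_subspace_dim n S' = mat_subspace_dim n (joint A B)"
    using mat_subspace_dim_mono[OF wt(1) calculation sub] weakly_triangularizable_dim_le_max[OF J] S'
    by (simp add: optimal_wt_def)
  ultimately have eq: "S' = joint A B" by (rule mat_subspace_dim_eq_imp_eq[OF wt(1) _ sub])
  then have "optimal_wt (a + b) (joint A B)" using S' n by simp
  from optimal_wt_joint_factors[OF A B this] show ?thesis
    using that[OF n(1) a(1) n(2)] sim eq by simp
qed

abbreviation irreducible_optimal_block :: "nat \<Rightarrow> 'a::field mat set \<Rightarrow> bool" where
  "irreducible_optimal_block k S \<equiv> 0 < k \<and> irreducible_optimal_wt k S"

lemma irreducible_optimal_blocks_iff:
  "irreducible_optimal_blocks ns Ss \<longleftrightarrow> list_all2 irreducible_optimal_block ns Ss"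
  by (auto simp: irreducible_optimal_blocks_def list_all2_conv_all_nth)

lemma irreducible_optimal_blocks_carrier:
  "irreducible_optimal_blocks ns Ss \<Longrightarrow> list_all2 (\<lambda>k S. S \<subseteq> carrier_mat k k) ns Ss"
  unfolding irreducible_optimal_blocks_iff
  by (erule list_all2_mono) (simp add: irreducible_optimal_wt_def optimal_wt_carrier)

lemma optimal_wt_similar_joints:
  fixes S :: "'a::field mat set"
  assumes "optimal_wt n S"
  shows "\<exists>ns Ss. sum_list ns = n \<and> irreducible_optimal_blocks ns Ss \<and> similar_sets n S (joints Ss)"
  using assms
proof (induction n arbitrary: S rule: less_induct)
  case (less n)
  have Sc: "S \<subseteq> carrier_mat n n" by (rule optimal_wt_carrier[OF less.prems])
  consider "n = 0" | "n > 0" "irreducible_mats n S" | "\<not> irreducible_mats n S" by blast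
  then show ?case
  proof cases
    case 1
    have "M = 0\<^sub>m 0 0" if "M \<in> carrier_mat 0 0" for M :: "'a mat"
      using that by (intro eq_matI) auto
    moreover have "0\<^sub>m n n \<in> S"
      using less.prems by (simp add: optimal_wt_def weakly_triangularizable_def mat_subspace_iff)
    ultimately have "S = joints []" using Sc 1 by auto
    then show ?thesis
      using 1 similar_sets_refl[OF Sc]
      by (intro exI[of _ "[]"]) (simp add: irreducible_optimal_blocks_iff)
  next
    case 2
    then show ?thesis
      using similar_sets_refl[OF Sc] less.prems
      by (intro exI[of _ "[n]"] exI[of _ "[S]"])
        (simp add: irreducible_optimal_blocks_iff irreducible_optimal_wt_def)
  next
    case 3
    then obtain a b A B where n: "n = a + b" "0 < a" "0 < b" and A: "optimal_wt a A" and B: "optimal_wt b B"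
      and sim: "similar_sets n S (joint A B)"
      by (rule reducible_optimal_wt_similar_joint[OF less.prems])
    obtain as As where as: "sum_list as = a" "irreducible_optimal_blocks as As" "similar_sets a A (joints As)"
      using less.IH[of a A] A n by auto
    obtain bs Bs where bs: "sum_list bs = b" "irreducible_optimal_blocks bs Bs" "similar_sets b B (joints Bs)"
      using less.IH[of b B] B n by auto
    have "similar_sets n (joint A B) (joint (joints As) (joints Bs))"
      using similar_sets_joint[OF optimal_wt_carrier[OF A] optimal_wt_carrier[OF B] as(3) bs(3)] n by simp
    also have "joint (joints As) (joints Bs) = joints (As @ Bs)"
      by (rule joints_append[OF irreducible_optimal_blocks_carrier[OF as(2)]
            irreducible_optimal_blocks_carrier[OF bs(2)], symmetric])
    finally have "similar_sets n S (joints (As @ Bs))"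
      by (rule similar_sets_trans[OF Sc sim])
    moreover have "irreducible_optimal_blocks (as @ bs) (As @ Bs)"
      using as(2) bs(2) by (simp add: irreducible_optimal_blocks_iff list_all2_appendI)
    ultimately show ?thesis using n as bs
      by (intro exI[of _ "as @ bs"] exI[of _ "As @ Bs"]) simp
  qed
qed

section \<open>Joints that reach the maximal dimension\<close>

lemma joints_weakly_triangularizable:
  fixes Ss :: "'a::field mat set list"
  assumes "list_all2 weakly_triangularizable ns Ss"
  shows "weakly_triangularizable (sum_list ns) (joints Ss) \<and>
    mat_subspace_dim (sum_list ns) (joints Ss) =
      (\<Sum>k<length ns. mat_subspace_dim (ns ! k) (Ss ! k)) +
      (\<Sum>j<length ns. \<Sum>i<j. ns ! i * ns ! j)"
  using assms
proof (induction rule: list_all2_induct)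
  case Nil
  have 0: "mat_subspace 0 {0\<^sub>m 0 0 :: 'a mat}"
    using zero_weakly_triangularizable[of 0, where 'a = 'a] by (simp add: weakly_triangularizable_def)
  have "mat_subspace_dim 0 {0\<^sub>m 0 0 :: 'a mat} = 0"
    using mat_subspace_dim_joint[OF 0 0] joint_zero_left[of "{0\<^sub>m 0 0 :: 'a mat}" 0] by simp
  then show ?case using zero_weakly_triangularizable[of 0, where 'a = 'a] by simp
next
  case (Cons a ns A Ss)
  have A: "mat_subspace a A" and S: "mat_subspace (sum_list ns) (joints Ss)"
    using Cons by (simp_all add: weakly_triangularizable_def)
  have shift: "(\<Sum>j<Suc m. f j) = f 0 + (\<Sum>j<m. f (Suc j))" for m and f :: "nat \<Rightarrow> nat"
    by (rule sum.lessThan_Suc_shift)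
  have "(\<Sum>j<length ns. a * ns ! j) = a * sum_list ns"
    by (simp add: sum_list_sum_nth sum_distrib_left atLeast0LessThan)
  then have pairs: "(\<Sum>j<length (a # ns). \<Sum>i<j. (a # ns) ! i * (a # ns) ! j) =
     a * sum_list ns + (\<Sum>j<length ns. \<Sum>i<j. ns ! i * ns ! j)"
    unfolding list.size add_0_right add_Suc_right shift by (simp add: shift sum.distrib del: sum.lessThan_Suc)
  have singles: "(\<Sum>k<length (a # ns). mat_subspace_dim ((a # ns) ! k) ((A # Ss) ! k)) =
     mat_subspace_dim a A + (\<Sum>k<length ns. mat_subspace_dim (ns ! k) (Ss ! k))"
    unfolding list.size add_0_right add_Suc_right shift by simp
  have eq: "joints (A # Ss) = joint A (joints Ss)"
    by (rule joints_Cons[OF mat_subspace_subsetD[OF A]])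
  have "weakly_triangularizable (a + sum_list ns) (joint A (joints Ss))"
    using weakly_triangularizable_joint[OF Cons(1)] Cons.IH by simp
  then show ?case
    unfolding pairs singles eq using mat_subspace_dim_joint[OF A S] Cons.IH by simp
qed

lemma optimal_wt_joints:
  fixes Ss :: "'a::field mat set list"
  assumes Ss: "irreducible_optimal_blocks ns Ss"
    and max: "max_wt_dim TYPE('a) (sum_list ns) =
              (\<Sum>k<length ns. max_wt_dim TYPE('a) (ns ! k)) +
              (\<Sum>j<length ns. \<Sum>i<j. ns ! i * ns ! j)"
  shows "optimal_wt (sum_list ns) (joints Ss)"
proof -
  have opt: "optimal_wt (ns ! k) (Ss ! k)" if "k < length ns" for k
    using Ss that by (simp add: irreducible_optimal_blocks_def irreducible_optimal_wt_def)
  have "list_all2 weakly_triangularizable ns Ss"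
    using opt Ss by (simp add: list_all2_conv_all_nth optimal_wt_def irreducible_optimal_blocks_def)
  from joints_weakly_triangularizable[OF this] show ?thesis
    using opt max by (simp add: optimal_wt_def)
qed

section \<open>Uniqueness of the factors\<close>

text \<open>
If \<open>a' < a\<close>, then row \<open>a'\<close> of the leading \<open>a \<times> a\<close> block of \<open>P\<close> vanishes, while \<open>P\<close> is block
upper triangular; so \<open>P\<close> would be singular.
\<close>
lemma coord_space_le_of_injective:
  fixes P :: "'a::field mat"
  assumes P: "P \<in> carrier_mat n n" and det: "det P \<noteq> 0" and "a \<le> n"
    and maps: "\<And>v. v \<in> coord_space n a \<Longrightarrow> P *\<^sub>v v \<in> coord_space n a'"
  shows "a \<le> a'"
proof (rule ccontr)
  assume "\<not> a \<le> a'"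
  then have less: "a' < a" by simp
  define b where "b = n - a"
  have n: "n = a + b" using \<open>a \<le> n\<close> by (simp add: b_def)
  have zero: "P $$ (r, c) = 0" if "a' \<le> r" "r < n" "c < a" for r c
  proof -
    have "P *\<^sub>v unit_vec n c \<in> coord_space n a'"
      using that by (intro maps) (auto simp: coord_space_def unit_vec_def)
    moreover have "(P *\<^sub>v unit_vec n c) $ r = P $$ (r, c)"
      using that P \<open>a \<le> n\<close> by auto
    ultimately show ?thesis using that by (auto simp: coord_space_def)
  qed
  let ?D = "diag_block 0 a P"
  have "block_upper a (a + b) P"
    using P n zero less by (auto simp: block_upper_def)
  from arg_cong[OF block_upper_eq_four_block[OF this], of det]
  have "det P = det ?D * det (diag_block a b P)"
    by (simp add: det_four_block_mat_lower_left_zero[of _ a _ b])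
  moreover have "det ?D = 0"
  proof -
    have "?D\<^sup>T *\<^sub>v unit_vec a a' = 0\<^sub>v a"
      using less zero n by (intro eq_vecI) auto
    moreover have "unit_vec a a' \<noteq> (0\<^sub>v a :: 'a vec)"
      using less by (metis index_unit_vec(1) index_zero_vec(1) zero_neq_one)
    ultimately have "det (?D\<^sup>T) = 0"
      using det_0_iff_vec_prod_zero[of "?D\<^sup>T" a] by (metis diag_block_carrier transpose_carrier_mat unit_vec_carrier)
    then show ?thesis by (simp add: det_transpose[of _ a])
  qed
  ultimately show False using det by simp
qed

text \<open>
If some \<open>w\<close> in \<open>W\<close> has a nonzero coordinate \<open>w $ i\<close> with \<open>a \<le> i\<close>, then any vector supported on
the first \<open>a\<close> coordinates is the image of \<open>w\<close> under a matrix with entries only in the upper right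
rectangle, and the joint contains all of these. Otherwise \<open>W\<close> itself is supported there, is invariant under the
irreducible space \<open>A\<close>, and hence consists of all such vectors.
\<close>
lemma invariant_subspace_contains_coord_space:
  fixes A R :: "'a::field mat set"
  assumes A: "mat_subspace a A" and irr: "irreducible_mats a A" and R: "mat_subspace b R"
    and W: "VectorSpace.subspace class_ring W (module_vec TYPE('a) (a + b))"
    and invar: "\<And>M w. M \<in> joint A R \<Longrightarrow> w \<in> W \<Longrightarrow> M *\<^sub>v w \<in> W"
    and nz: "W \<noteq> {0\<^sub>v (a + b)}"
  shows "coord_space (a + b) a \<subseteq> W"
proof
  let ?n = "a + b"
  fix v :: "'a vec" assume v: "v \<in> coord_space ?n a"
  note W' = W[unfolded vec_subspace_iff]
  have Wc: "w \<in> carrier_vec ?n" if "w \<in> W" for w using W' that by blast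
  note J = joint_eq[OF mat_subspace_subsetD[OF A] mat_subspace_subsetD[OF R]]
  have 0: "0\<^sub>m a a \<in> A" "0\<^sub>m b b \<in> R" using A R by (auto simp: mat_subspace_iff)
  show "v \<in> W"
  proof (cases "W \<subseteq> coord_space ?n a")
    case False
    then obtain w i where w: "w \<in> W" and i: "a \<le> i" "i < ?n" "w $ i \<noteq> 0"
      using Wc by (auto simp: coord_space_def)
    \<comment> \<open>The column \<open>i\<close> lies to the right of the leading block because \<open>a \<le> i\<close>.\<close>
    define M where "M = mat ?n ?n (\<lambda>(r, c). if c = i then v $ r / w $ i else 0)"
    have "diag_block 0 a M = 0\<^sub>m a a" "diag_block a b M = 0\<^sub>m b b"
      using v i by (auto simp: M_def coord_space_def intro!: eq_matI)
    moreover have "block_upper a ?n M" using i by (auto simp: block_upper_def M_def)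
    ultimately have "M \<in> joint A R" using 0 by (simp add: J)
    then have "M *\<^sub>v w \<in> W" using invar w by blast
    also have "M *\<^sub>v w = v"
    proof (rule eq_vecI)
      fix r assume "r < dim_vec v"
      then have r: "r < ?n" using v by (auto simp: coord_space_def)
      have "(M *\<^sub>v w) $ r = (\<Sum>c\<in>{0..<?n}. M $$ (r, c) * w $ c)"
        using r Wc[OF w] by (simp add: M_def scalar_prod_def)
      also have "\<dots> = (\<Sum>c\<in>{0..<?n}. if c = i then v $ r else 0)"
        using r i by (intro sum.cong) (auto simp: M_def)
      also have "\<dots> = v $ r" using i by simp
      finally show "(M *\<^sub>v w) $ r = v $ r" .
    qed (use v in \<open>auto simp: M_def coord_space_def\<close>)
    finally show ?thesis .
  next
    case True
    define U where "U = {u \<in> carrier_vec a. u @\<^sub>v 0\<^sub>v b \<in> W}"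
    have split: "w = vec a (\<lambda>i. w $ i) @\<^sub>v 0\<^sub>v b" if "w \<in> coord_space ?n a" for w :: "'a vec"
      using that by (intro eq_vecI) (auto simp: coord_space_def)
    have "VectorSpace.subspace class_ring U (module_vec TYPE('a) a)"
      unfolding vec_subspace_iff
    proof (intro conjI ballI allI)
      have "0\<^sub>v a @\<^sub>v 0\<^sub>v b = (0\<^sub>v ?n :: 'a vec)" by (intro eq_vecI) auto
      then show "0\<^sub>v a \<in> U" using W' by (simp add: U_def)
      show "x + y \<in> U" if "x \<in> U" "y \<in> U" for x y
      proof -
        have "(x + y) @\<^sub>v 0\<^sub>v b = (x @\<^sub>v 0\<^sub>v b) + (y @\<^sub>v 0\<^sub>v b)"
          using that by (intro eq_vecI) (auto simp: U_def)
        then show ?thesis using that W' by (simp add: U_def)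
      qed
      show "c \<cdot>\<^sub>v x \<in> U" if "x \<in> U" for c x
      proof -
        have "(c \<cdot>\<^sub>v x) @\<^sub>v 0\<^sub>v b = c \<cdot>\<^sub>v (x @\<^sub>v 0\<^sub>v b)"
          using that by (intro eq_vecI) (auto simp: U_def)
        then show ?thesis using that W' by (simp add: U_def)
      qed
    qed (auto simp: U_def)
    moreover have "X *\<^sub>v u \<in> U" if X: "X \<in> A" and u: "u \<in> U" for X u
    proof -
      let ?M = "four_block_mat X (0\<^sub>m a b) (0\<^sub>m b a) (0\<^sub>m b b)"
      have Xc: "X \<in> carrier_mat a a" using X mat_subspace_subsetD[OF A] by blast
      have "?M \<in> joint A R"
        using block_upper_four_block[OF Xc zero_carrier_mat[of b b] zero_carrier_mat[of a b]] X 0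
        by (simp add: J)
      then have "?M *\<^sub>v (u @\<^sub>v 0\<^sub>v b) \<in> W" using invar u by (simp add: U_def)
      also have "?M *\<^sub>v (u @\<^sub>v 0\<^sub>v b) = (X *\<^sub>v u) @\<^sub>v 0\<^sub>v b"
        using Xc u by (subst four_block_mat_mult_vec[of _ a a _ b _ b]) (auto simp: U_def)
      finally show ?thesis using Xc u by (simp add: U_def)
    qed
    ultimately have "U = {0\<^sub>v a} \<or> U = carrier_vec a"
      using irr by (simp add: irreducible_mats_def)
    moreover have "U \<noteq> {0\<^sub>v a}"
    proof
      assume U0: "U = {0\<^sub>v a}"
      have "w = 0\<^sub>v ?n" if "w \<in> W" for w
      proof -
        have w: "w = vec a (\<lambda>i. w $ i) @\<^sub>v 0\<^sub>v b" using split True that by blast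
        then have "vec a (\<lambda>i. w $ i) \<in> U" using that by (simp add: U_def)
        then have "vec a (\<lambda>i. w $ i) = 0\<^sub>v a" using U0 by simp
        then have "w = 0\<^sub>v a @\<^sub>v 0\<^sub>v b" using w by simp
        then show ?thesis by (auto intro!: eq_vecI)
      qed
      then show False using nz W' by blast
    qed
    ultimately have "vec a (\<lambda>i. v $ i) \<in> U" by simp
    then show ?thesis using split[OF v] by (simp add: U_def)
  qed
qed

text \<open>
The preimage \<open>W\<close> under \<open>P\<close> of the first \<open>a'\<close> coordinates is a nonzero subspace invariant under the
joint of \<open>A\<close> and \<open>R\<close>, so it contains the least such subspace.
\<close>
lemma conj_maps_coord_space:
  fixes A R A' R' :: "'a::field mat set"
  assumes A: "mat_subspace a A" "irreducible_mats a A" and R: "mat_subspace r R"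
    and A': "mat_subspace a' A'" and R': "mat_subspace r' R'"
    and n: "n = a + r" "n = a' + r'" and "0 < a'"
    and PQ: "P \<in> carrier_mat n n" "Q \<in> carrier_mat n n" "P * Q = 1\<^sub>m n" "Q * P = 1\<^sub>m n"
    and J: "joint A' R' = (\<lambda>M. P * M * Q) ` joint A R"
    and v: "v \<in> coord_space n a"
  shows "P *\<^sub>v v \<in> coord_space n a'"
proof -
  define W where "W = {w \<in> carrier_vec n. P *\<^sub>v w \<in> coord_space n a'}"
  have "VectorSpace.subspace class_ring W (module_vec TYPE('a) n)"
    unfolding vec_subspace_iff
  proof (intro conjI ballI allI)
    show "0\<^sub>v n \<in> W" using PQ by (auto simp: W_def coord_space_def scalar_prod_def)
    show "x + y \<in> W" if "x \<in> W" "y \<in> W" for x y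
    proof -
      have "P *\<^sub>v (x + y) = P *\<^sub>v x + P *\<^sub>v y"
        using that PQ by (intro mult_add_distrib_mat_vec[of _ n n]) (auto simp: W_def)
      then show ?thesis using that PQ by (auto simp: W_def coord_space_def simp del: index_mult_mat_vec)
    qed
    show "c \<cdot>\<^sub>v x \<in> W" if "x \<in> W" for c x
    proof -
      have "P *\<^sub>v (c \<cdot>\<^sub>v x) = c \<cdot>\<^sub>v (P *\<^sub>v x)"
        using that PQ by (intro mult_mat_vec[of _ n n]) (auto simp: W_def)
      then show ?thesis using that PQ by (auto simp: W_def coord_space_def simp del: index_mult_mat_vec)
    qed
  qed (auto simp: W_def)
  moreover have "M *\<^sub>v w \<in> W" if M: "M \<in> joint A R" and w: "w \<in> W" for M w
  proof -
    have Mc: "M \<in> carrier_mat n n"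
      using M joint_carrier[OF mat_subspace_subsetD[OF A(1)] mat_subspace_subsetD[OF R]] n by blast
    have wc: "w \<in> carrier_vec n" using w by (simp add: W_def)
    have "P * M * Q \<in> joint A' R'" using M J by blast
    then have "block_upper a' n (P * M * Q)"
      using joint_eq[OF mat_subspace_subsetD[OF A'] mat_subspace_subsetD[OF R']] n by simp
    then have "(P * M * Q) *\<^sub>v (P *\<^sub>v w) \<in> coord_space n a'"
      using block_upper_iff_coord_space_invariant[of "P * M * Q" n a'] PQ Mc w n by (simp add: W_def)
    also have "(P * M * Q) *\<^sub>v (P *\<^sub>v w) = (P * M) *\<^sub>v ((Q * P) *\<^sub>v w)"
      using PQ(1,2) Mc wc by (simp add: assoc_mult_mat_vec[of _ n n _ n] mult_carrier_mat[of _ n n])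
    also have "\<dots> = P *\<^sub>v (M *\<^sub>v w)"
      using PQ Mc wc by (simp add: assoc_mult_mat_vec[of _ n n _ n])
    finally show ?thesis using Mc wc by (simp add: W_def)
  qed
  moreover have "W \<noteq> {0\<^sub>v n}"
  proof
    assume W0: "W = {0\<^sub>v n}"
    have PQe: "P *\<^sub>v (Q *\<^sub>v unit_vec n 0) = unit_vec n 0"
      using PQ by (metis assoc_mult_mat_vec one_mult_mat_vec unit_vec_carrier)
    then have "Q *\<^sub>v unit_vec n 0 \<in> W"
      using PQ \<open>0 < a'\<close> by (simp add: W_def) (simp add: coord_space_def)
    then have "P *\<^sub>v 0\<^sub>v n = unit_vec n 0" using PQe W0 by simp
    moreover have "0 < n" using n(2) \<open>0 < a'\<close> by simp
    moreover from this have "(P *\<^sub>v 0\<^sub>v n) $ 0 = 0"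
      using PQ(1) by (simp add: scalar_prod_def)
    ultimately show False by simp
  qed
  ultimately have "coord_space n a \<subseteq> W"
    using invariant_subspace_contains_coord_space[OF A R, of W] n(1) by simp
  then show ?thesis using v by (auto simp: W_def)
qed

lemma det_nonzero_of_inverse:
  fixes P Q :: "'a::field mat"
  assumes "P \<in> carrier_mat n n" "Q \<in> carrier_mat n n" "P * Q = 1\<^sub>m n"
  shows "det P \<noteq> 0"
  using det_mult[OF assms(1,2)] assms(3) by auto

text \<open>
Applying \<open>conj_maps_coord_space\<close> to \<open>P\<close> and to its inverse \<open>Q\<close> gives inequalities between \<open>a\<close> and \<open>a'\<close>
in both directions. Then \<open>P\<close> and \<open>Q\<close> are both block upper triangular, so taking diagonal blocks is
multiplicative on every product \<open>P * M * Q\<close>.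
\<close>
lemma similar_joints_factors:
  fixes A R A' R' :: "'a::field mat set"
  assumes A: "mat_subspace a A" "irreducible_mats a A" "0 < a" and R: "mat_subspace r R"
    and A': "mat_subspace a' A'" "irreducible_mats a' A'" "0 < a'" and R': "mat_subspace r' R'"
    and eq: "a + r = a' + r'"
    and sim: "similar_sets (a + r) (joint A R) (joint A' R')"
  shows "a = a'" "similar_sets a A A'" "similar_sets r R R'"
proof -
  define n where "n = a + r"
  have n: "n = a + r" "n = a' + r'" using eq by (auto simp: n_def)
  obtain P Q where PQ: "P \<in> carrier_mat n n" "Q \<in> carrier_mat n n" "P * Q = 1\<^sub>m n" "Q * P = 1\<^sub>m n"
    and J': "joint A' R' = (\<lambda>M. P * M * Q) ` joint A R"
    using sim unfolding similar_sets_def n(1) by blast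
  note Ac = mat_subspace_subsetD[OF A(1)] and Rc = mat_subspace_subsetD[OF R]
    and A'c = mat_subspace_subsetD[OF A'(1)] and R'c = mat_subspace_subsetD[OF R']
  have Jc: "joint A R \<subseteq> carrier_mat n n" using joint_carrier[OF Ac Rc] n by simp
  have "(\<lambda>M. Q * (P * M * Q) * P) ` joint A R = (\<lambda>M. M) ` joint A R"
    using Jc PQ by (intro image_cong) (auto intro!: mat_conj_cancel[of _ n])
  then have J: "joint A R = (\<lambda>M. Q * M * P) ` joint A' R'"
    unfolding J' image_image by simp
  have P: "P *\<^sub>v v \<in> coord_space n a'" if "v \<in> coord_space n a" for v
    by (rule conj_maps_coord_space[OF A(1,2) R A'(1) R' n A'(3) PQ J' that])
  have Q: "Q *\<^sub>v v \<in> coord_space n a" if "v \<in> coord_space n a'" for v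
    by (rule conj_maps_coord_space[OF A'(1,2) R' A(1) R n(2,1) A(3) PQ(2,1,4,3) J that])
  show aa: "a = a'"
  proof (rule antisym)
    show "a \<le> a'"
      using coord_space_le_of_injective[OF PQ(1) det_nonzero_of_inverse[OF PQ(1-3)]] P n by simp
    show "a' \<le> a"
      using coord_space_le_of_injective[OF PQ(2) det_nonzero_of_inverse[OF PQ(2,1,4)]] Q n by simp
  qed
  then have rr: "r = r'" using eq by simp
  have bP: "block_upper a (a + r) P" and bQ: "block_upper a (a + r) Q"
    using block_upper_iff_coord_space_invariant[of _ n a] PQ P Q aa n by auto
  note inv1 = block_upper_mult[OF bP bQ] and inv2 = block_upper_mult[OF bQ bP]
  have diag: "diag_block i k (P * M * Q) = diag_block i k P * diag_block i k M * diag_block i k Q"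
    if "M \<in> joint A R" "(i, k) = (0, a) \<or> (i, k) = (a, r)" for M i k
  proof -
    have "block_upper a (a + r) M" using that by (simp add: joint_eq[OF Ac Rc])
    note PM = block_upper_mult[OF bP this]
    show ?thesis using that(2) PM(2,3) block_upper_mult(2,3)[OF PM(1) bQ] by auto
  qed
  have ne: "A \<noteq> {}" "R \<noteq> {}" "A' \<noteq> {}" "R' \<noteq> {}"
    using A R A' R' by (auto simp: mat_subspace_iff)
  have "A' = diag_block 0 a ` joint A' R'"
    using diag_block_image_joint(1)[OF A'c R'c ne(4)] aa by simp
  also have "\<dots> = (\<lambda>M. diag_block 0 a P * diag_block 0 a M * diag_block 0 a Q) ` joint A R"
    unfolding J' image_image by (intro image_cong refl diag) auto
  also have "\<dots> = (\<lambda>X. diag_block 0 a P * X * diag_block 0 a Q) ` A"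
    by (subst (2) diag_block_image_joint(1)[OF Ac Rc ne(2), symmetric]) (simp add: image_image)
  finally show "similar_sets a A A'"
    using inv1(2) inv2(2) PQ n unfolding similar_sets_def
    by (intro exI[of _ "diag_block 0 a P"] exI[of _ "diag_block 0 a Q"]) simp
  have "R' = diag_block a r ` joint A' R'"
    using diag_block_image_joint(2)[OF A'c R'c ne(3)] aa rr by simp
  also have "\<dots> = (\<lambda>M. diag_block a r P * diag_block a r M * diag_block a r Q) ` joint A R"
    unfolding J' image_image by (intro image_cong refl diag) auto
  also have "\<dots> = (\<lambda>X. diag_block a r P * X * diag_block a r Q) ` R"
    by (subst (2) diag_block_image_joint(2)[OF Ac Rc ne(1), symmetric]) (simp add: image_image)
  finally show "similar_sets r R R'"
    using inv1(3) inv2(3) PQ n unfolding similar_sets_def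
    by (intro exI[of _ "diag_block a r P"] exI[of _ "diag_block a r Q"]) simp
qed

lemma mat_subspace_joints:
  fixes Ss :: "'a::field mat set list"
  assumes "list_all2 mat_subspace ns Ss"
  shows "mat_subspace (sum_list ns) (joints Ss)"
  using assms
proof (induction rule: list_all2_induct)
  case Nil
  show ?case by (auto simp: mat_subspace_iff)
next
  case (Cons a ns A Ss)
  then show ?case
    using mat_subspace_joint[OF Cons(1) Cons.IH] joints_Cons[OF mat_subspace_subsetD[OF Cons(1)]] by simp
qed

abbreviation irreducible_block :: "nat \<Rightarrow> 'a::field mat set \<Rightarrow> bool" where
  "irreducible_block k S \<equiv> 0 < k \<and> mat_subspace k S \<and> irreducible_mats k S"

lemma similar_joints_unique:
  fixes Ss Ss' :: "'a::field mat set list"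
  assumes "list_all2 irreducible_block ns Ss" "list_all2 irreducible_block ns' Ss'"
    and "sum_list ns = sum_list ns'"
    and "similar_sets (sum_list ns) (joints Ss) (joints Ss')"
  shows "ns = ns' \<and> (\<forall>i<length ns. similar_sets (ns ! i) (Ss ! i) (Ss' ! i))"
  using assms
proof (induction arbitrary: ns' Ss' rule: list_all2_induct)
  case Nil
  then show ?case by (cases ns'; cases Ss') auto
next
  case (Cons a ns A Ss)
  obtain a' ms' A' Ts' where ns': "ns' = a' # ms'" and Ss': "Ss' = A' # Ts'"
    using Cons.prems(1,2) Cons.hyps(1) by (cases ns'; cases Ss') auto
  have A: "mat_subspace a A" "irreducible_mats a A" "0 < a"
    and A': "mat_subspace a' A'" "irreducible_mats a' A'" "0 < a'"
    and Ts': "list_all2 irreducible_block ms' Ts'"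
    using Cons.hyps(1) Cons.prems(1) by (simp_all add: ns' Ss')
  have R: "mat_subspace (sum_list ns) (joints Ss)" "mat_subspace (sum_list ms') (joints Ts')"
    by (rule mat_subspace_joints, rule list_all2_mono[OF Cons.hyps(2)], simp)
      (rule mat_subspace_joints, rule list_all2_mono[OF Ts'], simp)
  have eq: "a + sum_list ns = a' + sum_list ms'" using Cons.prems(2) ns' by simp
  have "similar_sets (a + sum_list ns) (joint A (joints Ss)) (joint A' (joints Ts'))"
    using Cons.prems(3) joints_Cons[OF mat_subspace_subsetD[OF A(1)]]
      joints_Cons[OF mat_subspace_subsetD[OF A'(1)]] Ss' by simp
  note step = similar_joints_factors[OF A R(1) A' R(2) eq this]
  have IH: "ns = ms'" "\<And>i. i < length ns \<Longrightarrow> similar_sets (ns ! i) (Ss ! i) (Ts' ! i)"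
    using Cons.IH[OF Ts' _ step(3)] eq step(1) by auto
  have "similar_sets ((a # ns) ! i) ((A # Ss) ! i) (Ss' ! i)" if "i < length (a # ns)" for i
    using that step(2) IH(2) Ss' by (cases i) simp_all
  then show ?case
    using step(1) IH(1) ns' by simp
qed

theorem theorem1p2:
  shows "(\<forall>n (S :: 'a::field mat set). optimal_wt n S \<longrightarrow>
            (\<exists>ns Ss. sum_list ns = n \<and> irreducible_optimal_blocks ns Ss \<and>
                     similar_sets n S (joints Ss)))
       \<and> (\<forall>n (S :: 'a mat set) S' ns Ss ns' Ss'.
            optimal_wt n S \<and> similar_sets n S S' \<and>
            sum_list ns = n \<and> irreducible_optimal_blocks ns Ss \<and>
            similar_sets n S (joints Ss) \<and>
            sum_list ns' = n \<and> irreducible_optimal_blocks ns' Ss' \<and>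
            similar_sets n S' (joints Ss') \<longrightarrow>
            ns = ns' \<and> (\<forall>i<length ns. similar_sets (ns ! i) (Ss ! i) (Ss' ! i)))
       \<and> (\<forall>n ns (Ss :: 'a mat set list).
            sum_list ns = n \<and> irreducible_optimal_blocks ns Ss \<and>
            max_wt_dim TYPE('a) n =
              (\<Sum>k<length ns. max_wt_dim TYPE('a) (ns ! k)) +
              (\<Sum>j<length ns. \<Sum>i<j. ns ! i * ns ! j) \<longrightarrow>
            optimal_wt n (joints Ss))"
proof (intro conjI allI impI; (elim conjE)?)
  fix n and S :: "'a mat set"
  assume "optimal_wt n S"
  then show "\<exists>ns Ss. sum_list ns = n \<and> irreducible_optimal_blocks ns Ss \<and> similar_sets n S (joints Ss)"
    by (rule optimal_wt_similar_joints)
next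
  fix n ns ns' and S S' :: "'a mat set" and Ss Ss' :: "'a mat set list"
  assume S: "optimal_wt n S" and SS': "similar_sets n S S'"
    and ns: "sum_list ns = n" "irreducible_optimal_blocks ns Ss" "similar_sets n S (joints Ss)"
    and ns': "sum_list ns' = n" "irreducible_optimal_blocks ns' Ss'" "similar_sets n S' (joints Ss')"
  have Sc: "S \<subseteq> carrier_mat n n" by (rule optimal_wt_carrier[OF S])
  have "similar_sets n S (joints Ss')"
    by (rule similar_sets_trans[OF Sc SS' ns'(3)])
  then have "similar_sets n (joints Ss) (joints Ss')"
    by (rule similar_sets_trans[OF similar_sets_carrier[OF Sc ns(3)] similar_sets_sym[OF Sc ns(3)]])
  then have sim: "similar_sets (sum_list ns) (joints Ss) (joints Ss')"
    using ns(1) by simp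
  have blocks: "list_all2 irreducible_block ms Ts"
    if "irreducible_optimal_blocks ms Ts" for ms and Ts :: "'a mat set list"
    using that unfolding irreducible_optimal_blocks_iff
    by (rule list_all2_mono)
      (simp add: irreducible_optimal_wt_def optimal_wt_def weakly_triangularizable_def)
  have "ns = ns' \<and> (\<forall>i<length ns. similar_sets (ns ! i) (Ss ! i) (Ss' ! i))"
    by (rule similar_joints_unique[OF blocks[OF ns(2)] blocks[OF ns'(2)] _ sim])
      (simp add: ns(1) ns'(1))
  then show "ns = ns'" "\<And>i. i < length ns \<Longrightarrow> similar_sets (ns ! i) (Ss ! i) (Ss' ! i)"
    by auto
next
  fix n ns and Ss :: "'a mat set list"
  assume "sum_list ns = n" and "irreducible_optimal_blocks ns Ss"
    and "max_wt_dim TYPE('a) n =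
              (\<Sum>k<length ns. max_wt_dim TYPE('a) (ns ! k)) +
              (\<Sum>j<length ns. \<Sum>i<j. ns ! i * ns ! j)"
  then show "optimal_wt n (joints Ss)"
    using optimal_wt_joints[of ns Ss] by simp
qed

end
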